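(* Let $\mathfrak A$ be a unital Banach algebra and $S\triangleleft\ell^\infty$ a symmetric ideal such that $\alpha\in S$ implies $\sqrt{|\alpha|}\in S$. Then $I_{S(\mathfrak A)}$ is flat both as a left and as a right $\Gamma^\infty(\mathfrak A)$-module.
   Context: $\ell^\infty=\ell^\infty(\mathbb N,\mathbb C)$. An ideal $S\triangleleft\ell^\infty$ is symmetric if it is stable under $\alpha\mapsto f_*(\alpha)$ for every partially defined injection $f:\mathbb N\supset\mathrm{dom}f\to\mathbb N$, where $f_*(\alpha)_n=\alpha_m$ if $n=f(m)$, and $0$ if $n\notin\mathrm{ran}f$. For a countably infinite set $X$, $S(X,\mathfrak A)$ is the set of bounded maps $\alpha:X\to\mathfrak A$ with $(\|\alpha_x\|)_{x\in X}\in S$ (via any bijection $X\cong\mathbb N$). $I_{S(\mathfrak A)}$ is the set of matrices $A=(A_{ij})_{i,j\in\mathbb N}$ with $(A_{ij})\in S(\mathbb N\times\mathbb N,\mathfrak A)$ for which there is a uniform finite bound on the number of nonzero entries in each row and column; $\Gamma^\infty(\mathfrak A)=I_{\ell^\infty(\mathfrak A)}$ is a unital ring under matrix multiplication and $I_{S(\mathfrak A)}$ is a two-sided ideal in it. *)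

theory Defs
  imports
    "HOL-Analysis.Elementary_Normed_Spaces"
    "HOL-Algebra.Ideal"
    "HOL-Algebra.Module"
    "HOL-Algebra.Generated_Groups"
    "HOL-Algebra.Free_Abelian_Groups"
begin

section \<open>Unital complex Banach algebras\<close>

text \<open>The norm is only required to be submultiplicative: neither \<open>norm 1 = 1\<close> nor \<open>0 \<noteq> 1\<close> is
  imposed. The complex scalar multiplication extends the real one of the underlying classes.\<close>

class complex_banach_algebra_unital = real_normed_algebra + banach + monoid_mult +
  fixes scaleC :: "complex \<Rightarrow> 'a \<Rightarrow> 'a"
  assumes scaleC_add_right: "scaleC c (x + y) = scaleC c x + scaleC c y"
    and scaleC_add_left: "scaleC (c + d) x = scaleC c x + scaleC d x"
    and scaleC_scaleC: "scaleC c (scaleC d x) = scaleC (c * d) x"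
    and scaleC_of_real: "scaleC (complex_of_real r) x = scaleR r x"
    and norm_scaleC: "norm (scaleC c x) = cmod c * norm x"
    and scaleC_mult_left: "scaleC c x * y = scaleC c (x * y)"
    and scaleC_mult_right: "x * scaleC c y = scaleC c (x * y)"

section \<open>Symmetric ideals of bounded sequences\<close>

definition linf :: "(nat \<Rightarrow> complex) set" where
  "linf = {\<alpha>. bounded (range \<alpha>)}"

definition linf_ring :: "(nat \<Rightarrow> complex) ring" where
  "linf_ring = \<lparr>carrier = linf, mult = (\<lambda>\<alpha> \<beta> n. \<alpha> n * \<beta> n), one = (\<lambda>n. 1),
     ring.zero = (\<lambda>n. 0), add = (\<lambda>\<alpha> \<beta> n. \<alpha> n + \<beta> n)\<rparr>"

definition partial_inj :: "(nat \<Rightarrow> nat option) \<Rightarrow> bool" where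
  "partial_inj f \<longleftrightarrow> inj_on f (dom f)"

definition push_forward :: "(nat \<Rightarrow> nat option) \<Rightarrow> (nat \<Rightarrow> complex) \<Rightarrow> nat \<Rightarrow> complex" where
  "push_forward f \<alpha> n = (if n \<in> ran f then \<alpha> (THE m. f m = Some n) else 0)"

definition symmetric_ideal :: "(nat \<Rightarrow> complex) set \<Rightarrow> bool" where
  "symmetric_ideal S \<longleftrightarrow> ideal S linf_ring \<and>
     (\<forall>f \<alpha>. partial_inj f \<longrightarrow> \<alpha> \<in> S \<longrightarrow> push_forward f \<alpha> \<in> S)"

text \<open>The index set is a whole type, meant to be countably infinite. For a symmetric ideal the choice
  of the bijection does not matter, see \<open>seq_space_iff\<close> below.\<close>

definition seq_space :: "(nat \<Rightarrow> complex) set \<Rightarrow> ('x \<Rightarrow> 'a::real_normed_vector) set" where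
  "seq_space S = {\<alpha>. bounded (range \<alpha>) \<and>
     (\<exists>e :: nat \<Rightarrow> 'x. bij e \<and> (\<lambda>n. complex_of_real (norm (\<alpha> (e n)))) \<in> S)}"

lemma seq_space_iff:
  fixes \<alpha> :: "'x \<Rightarrow> 'a::real_normed_vector" and e :: "nat \<Rightarrow> 'x"
  assumes S: "symmetric_ideal S" and e: "bij e"
  shows "\<alpha> \<in> seq_space S \<longleftrightarrow>
    bounded (range \<alpha>) \<and> (\<lambda>n. complex_of_real (norm (\<alpha> (e n)))) \<in> S"
proof -
  have "(\<lambda>n. complex_of_real (norm (\<alpha> (e n)))) \<in> S"
    if e': "bij e'" and m: "(\<lambda>n. complex_of_real (norm (\<alpha> (e' n)))) \<in> S" for e' :: "nat \<Rightarrow> 'x"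
  proof -
    define g where "g = inv_into UNIV e \<circ> e'"
    have g: "bij g"
      unfolding g_def using e e' by (simp add: bij_comp bij_imp_bij_inv)
    define f where "f = (\<lambda>n. Some (g n))"
    have "partial_inj f"
      unfolding partial_inj_def f_def using g by (auto simp: bij_def inj_on_def)
    moreover have "push_forward f (\<lambda>n. complex_of_real (norm (\<alpha> (e' n)))) n =
        complex_of_real (norm (\<alpha> (e n)))" for n
    proof -
      obtain m where m: "g m = n"
        using g by (metis bij_pointE)
      have "(THE m. f m = Some n) = m"
        unfolding f_def using g m by (auto simp: bij_def inj_def)
      moreover have "n \<in> ran f"
        using m by (auto simp: f_def ran_def)
      moreover have "e' m = e n"
        using m e by (auto simp: g_def bij_is_surj surj_f_inv_f)
      ultimately show ?thesis
        by (simp add: push_forward_def)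
    qed
    ultimately show ?thesis
      using S m unfolding symmetric_ideal_def by (metis (no_types, lifting) ext)
  qed
  then show ?thesis
    using e by (auto simp: seq_space_def)
qed

section \<open>The matrix ring and its ideals\<close>

definition row_col_bounded :: "(nat \<Rightarrow> nat \<Rightarrow> 'a::zero) \<Rightarrow> bool" where
  "row_col_bounded A \<longleftrightarrow> (\<exists>K::nat.
     (\<forall>i. finite {j. A i j \<noteq> 0} \<and> card {j. A i j \<noteq> 0} \<le> K) \<and>
     (\<forall>j. finite {i. A i j \<noteq> 0} \<and> card {i. A i j \<noteq> 0} \<le> K))"

definition matrix_ideal ::
    "(nat \<Rightarrow> complex) set \<Rightarrow> (nat \<Rightarrow> nat \<Rightarrow> 'a::real_normed_vector) set" where
  "matrix_ideal S = {A. (\<lambda>(i, j). A i j) \<in> seq_space S \<and> row_col_bounded A}"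

definition mat_mult ::
    "(nat \<Rightarrow> nat \<Rightarrow> 'a::semiring_0) \<Rightarrow> (nat \<Rightarrow> nat \<Rightarrow> 'a) \<Rightarrow> nat \<Rightarrow> nat \<Rightarrow> 'a" where
  "mat_mult A B i k = (\<Sum>j \<in> {j. A i j \<noteq> 0}. A i j * B j k)"

definition Gamma_inf :: "(nat \<Rightarrow> nat \<Rightarrow> 'a::complex_banach_algebra_unital) ring" where
  "Gamma_inf = \<lparr>carrier = matrix_ideal linf, mult = mat_mult,
     one = (\<lambda>i j. if i = j then 1 else 0), ring.zero = (\<lambda>i j. 0),
     add = (\<lambda>A B i j. A i j + B i j)\<rparr>"

section \<open>One-sided modules over a not necessarily commutative ring\<close>

text \<open>The module record of the library is reused; as for \<^locale>\<open>module\<close>, its fields \<open>mult\<close> and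
  \<open>one\<close> play no role. For a right module \<open>smult M a x\<close> is to be read as \<open>x \<cdot> a\<close>.\<close>

locale left_module = R?: ring R + M?: abelian_group M
  for R (structure) and M (structure) +
  assumes smult_closed:
      "\<lbrakk>a \<in> carrier R; x \<in> carrier M\<rbrakk> \<Longrightarrow> a \<odot>\<^bsub>M\<^esub> x \<in> carrier M"
    and smult_l_distr:
      "\<lbrakk>a \<in> carrier R; b \<in> carrier R; x \<in> carrier M\<rbrakk> \<Longrightarrow>
        (a \<oplus>\<^bsub>R\<^esub> b) \<odot>\<^bsub>M\<^esub> x = a \<odot>\<^bsub>M\<^esub> x \<oplus>\<^bsub>M\<^esub> b \<odot>\<^bsub>M\<^esub> x"
    and smult_r_distr:
      "\<lbrakk>a \<in> carrier R; x \<in> carrier M; y \<in> carrier M\<rbrakk> \<Longrightarrow>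
        a \<odot>\<^bsub>M\<^esub> (x \<oplus>\<^bsub>M\<^esub> y) = a \<odot>\<^bsub>M\<^esub> x \<oplus>\<^bsub>M\<^esub> a \<odot>\<^bsub>M\<^esub> y"
    and smult_assoc:
      "\<lbrakk>a \<in> carrier R; b \<in> carrier R; x \<in> carrier M\<rbrakk> \<Longrightarrow>
        (a \<otimes>\<^bsub>R\<^esub> b) \<odot>\<^bsub>M\<^esub> x = a \<odot>\<^bsub>M\<^esub> (b \<odot>\<^bsub>M\<^esub> x)"
    and smult_one: "x \<in> carrier M \<Longrightarrow> \<one>\<^bsub>R\<^esub> \<odot>\<^bsub>M\<^esub> x = x"

locale right_module = R?: ring R + M?: abelian_group M
  for R (structure) and M (structure) +
  assumes smult_closed:
      "\<lbrakk>a \<in> carrier R; x \<in> carrier M\<rbrakk> \<Longrightarrow> a \<odot>\<^bsub>M\<^esub> x \<in> carrier M"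
    and smult_l_distr:
      "\<lbrakk>a \<in> carrier R; b \<in> carrier R; x \<in> carrier M\<rbrakk> \<Longrightarrow>
        (a \<oplus>\<^bsub>R\<^esub> b) \<odot>\<^bsub>M\<^esub> x = a \<odot>\<^bsub>M\<^esub> x \<oplus>\<^bsub>M\<^esub> b \<odot>\<^bsub>M\<^esub> x"
    and smult_r_distr:
      "\<lbrakk>a \<in> carrier R; x \<in> carrier M; y \<in> carrier M\<rbrakk> \<Longrightarrow>
        a \<odot>\<^bsub>M\<^esub> (x \<oplus>\<^bsub>M\<^esub> y) = a \<odot>\<^bsub>M\<^esub> x \<oplus>\<^bsub>M\<^esub> a \<odot>\<^bsub>M\<^esub> y"
    and smult_assoc:
      "\<lbrakk>a \<in> carrier R; b \<in> carrier R; x \<in> carrier M\<rbrakk> \<Longrightarrow>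
        (a \<otimes>\<^bsub>R\<^esub> b) \<odot>\<^bsub>M\<^esub> x = b \<odot>\<^bsub>M\<^esub> (a \<odot>\<^bsub>M\<^esub> x)"
    and smult_one: "x \<in> carrier M \<Longrightarrow> \<one>\<^bsub>R\<^esub> \<odot>\<^bsub>M\<^esub> x = x"

definition linear_maps ::
    "('r, 'b) ring_scheme \<Rightarrow> ('r, 'm, 'c) module_scheme \<Rightarrow> ('r, 'n, 'd) module_scheme
      \<Rightarrow> ('m \<Rightarrow> 'n) set" where
  "linear_maps R M N = {f \<in> hom (add_monoid M) (add_monoid N).
     \<forall>a \<in> carrier R. \<forall>x \<in> carrier M. f (a \<odot>\<^bsub>M\<^esub> x) = a \<odot>\<^bsub>N\<^esub> f x}"

section \<open>Tensor products and flatness\<close>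

text \<open>For a right module \<open>M\<close> and a left module \<open>N\<close>, the abelian group \<open>M \<otimes>\<^bsub>R\<^esub> N\<close> is the free
  abelian group on pairs modulo biadditivity and \<open>(x \<cdot> a, y) \<sim> (x, a \<cdot> y)\<close>.\<close>

definition tensor_relations ::
    "('r, 'b) ring_scheme \<Rightarrow> ('r, 'm, 'c) module_scheme \<Rightarrow> ('r, 'n, 'd) module_scheme
      \<Rightarrow> ('m \<times> 'n \<Rightarrow>\<^sub>0 int) set" where
  "tensor_relations R M N =
     {frag_of (x \<oplus>\<^bsub>M\<^esub> x', y) - frag_of (x, y) - frag_of (x', y) | x x' y.
        x \<in> carrier M \<and> x' \<in> carrier M \<and> y \<in> carrier N} \<union>
     {frag_of (x, y \<oplus>\<^bsub>N\<^esub> y') - frag_of (x, y) - frag_of (x, y') | x y y'.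
        x \<in> carrier M \<and> y \<in> carrier N \<and> y' \<in> carrier N} \<union>
     {frag_of (a \<odot>\<^bsub>M\<^esub> x, y) - frag_of (x, a \<odot>\<^bsub>N\<^esub> y) | a x y.
        a \<in> carrier R \<and> x \<in> carrier M \<and> y \<in> carrier N}"

definition tensor_kernel ::
    "('r, 'b) ring_scheme \<Rightarrow> ('r, 'm, 'c) module_scheme \<Rightarrow> ('r, 'n, 'd) module_scheme
      \<Rightarrow> ('m \<times> 'n \<Rightarrow>\<^sub>0 int) set" where
  "tensor_kernel R M N =
     generate (free_Abelian_group (carrier M \<times> carrier N)) (tensor_relations R M N)"

definition tensor_product ::
    "('r, 'b) ring_scheme \<Rightarrow> ('r, 'm, 'c) module_scheme \<Rightarrow> ('r, 'n, 'd) module_scheme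
      \<Rightarrow> ('m \<times> 'n \<Rightarrow>\<^sub>0 int) set monoid" where
  "tensor_product R M N =
     free_Abelian_group (carrier M \<times> carrier N) Mod tensor_kernel R M N"

text \<open>The map \<open>f \<otimes> g\<close> from \<open>M \<otimes>\<^bsub>R\<^esub> N\<close> to \<open>M' \<otimes>\<^bsub>R\<^esub> N'\<close>, only meaningful for linear \<open>f\<close> and
  \<open>g\<close>; then the coset taken below is the same for all representatives in \<open>C\<close>.\<close>

definition tensor_map ::
    "('r, 'b) ring_scheme \<Rightarrow> ('r, 'm2, 'c) module_scheme \<Rightarrow> ('r, 'n2, 'd) module_scheme
      \<Rightarrow> ('m \<Rightarrow> 'm2) \<Rightarrow> ('n \<Rightarrow> 'n2)
      \<Rightarrow> ('m \<times> 'n \<Rightarrow>\<^sub>0 int) set \<Rightarrow> ('m2 \<times> 'n2 \<Rightarrow>\<^sub>0 int) set" where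
  "tensor_map R M' N' f g C =
     the_elem ((\<lambda>c. tensor_kernel R M' N'
                  #>\<^bsub>free_Abelian_group (carrier M' \<times> carrier N')\<^esub>
                  frag_extend (\<lambda>(x, y). frag_of (f x, g y)) c) ` C)"

text \<open>Flatness: tensoring preserves injectivity of linear maps. Since one cannot quantify over types
  inside a formula, the types of the elements of the test modules are parameters; flatness proper is
  the statement with these left as type variables.\<close>

definition flat_right_module ::
    "'k itself \<Rightarrow> 'l itself \<Rightarrow> ('r, 'b) ring_scheme \<Rightarrow> ('r, 'm, 'c) module_scheme \<Rightarrow> bool" where
  "flat_right_module _ _ R M \<longleftrightarrow> right_module R M \<and>
     (\<forall>(K :: ('r, 'k) module) (L :: ('r, 'l) module) f.
        left_module R K \<and> left_module R L \<and> f \<in> linear_maps R K L \<and> inj_on f (carrier K) \<longrightarrow>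
        inj_on (tensor_map R M L id f) (carrier (tensor_product R M K)))"

definition flat_left_module ::
    "'k itself \<Rightarrow> 'l itself \<Rightarrow> ('r, 'b) ring_scheme \<Rightarrow> ('r, 'm, 'c) module_scheme \<Rightarrow> bool" where
  "flat_left_module _ _ R M \<longleftrightarrow> left_module R M \<and>
     (\<forall>(K :: ('r, 'k) module) (L :: ('r, 'l) module) f.
        right_module R K \<and> right_module R L \<and> f \<in> linear_maps R K L \<and> inj_on f (carrier K) \<longrightarrow>
        inj_on (tensor_map R L M f id) (carrier (tensor_product R K M)))"

section \<open>The matrix ideals as modules\<close>

text \<open>The left and right actions are multiplication in the ring of matrices; the fields \<open>mult\<close> and
  \<open>one\<close> are irrelevant.\<close>

definition matrix_ideal_left :: "(nat \<Rightarrow> complex) set \<Rightarrow>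
    (nat \<Rightarrow> nat \<Rightarrow> 'a, nat \<Rightarrow> nat \<Rightarrow> 'a::complex_banach_algebra_unital) module" where
  "matrix_ideal_left S = \<lparr>carrier = matrix_ideal S, mult = mat_mult, one = undefined,
     ring.zero = (\<lambda>i j. 0), add = (\<lambda>A B i j. A i j + B i j), smult = (\<lambda>G A. mat_mult G A)\<rparr>"

definition matrix_ideal_right :: "(nat \<Rightarrow> complex) set \<Rightarrow>
    (nat \<Rightarrow> nat \<Rightarrow> 'a, nat \<Rightarrow> nat \<Rightarrow> 'a::complex_banach_algebra_unital) module" where
  "matrix_ideal_right S = \<lparr>carrier = matrix_ideal S, mult = mat_mult, one = undefined,
     ring.zero = (\<lambda>i j. 0), add = (\<lambda>A B i j. A i j + B i j), smult = (\<lambda>G A. mat_mult A G)\<rparr>"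

end

theory Submission
  imports Defs
begin

text \<open>A matrix in the ideal of \<open>S\<close> can be divided column by column by any weight \<open>w \<in> S\<close> dominating the
  suprema of the norms of its columns, so it lies in \<open>\<Gamma>\<^sup>\<infinity> diag(w)\<close>. This principal left
  ideal is projective, being isomorphic to the one generated by the support idempotent of \<open>w\<close>, and these
  ideals are directed because \<open>v, w \<le> v + w\<close>; a directed union of flat modules is flat. On elements this reads as follows: for \<open>w\<close>
  large, \<open>\<Sum> k\<^sub>i \<otimes> A\<^sub>i = (\<Sum> k\<^sub>i (A\<^sub>i/w)) \<otimes> diag(w)\<close>, and the element \<open>\<Sum> k\<^sub>i (A\<^sub>i/w)\<close> eventually
  vanishes if the tensor does, because each of the finitely many relations involved is respected as soon
  as \<open>w\<close> dominates the matrices occurring in it. The right-hand case is the same with rows in place of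
  columns, over the opposite ring.\<close>

section \<open>Kernels of tensor products\<close>

lemma tensor_relationsE [consumes 1, case_names add_left add_right smult]:
  assumes "r \<in> tensor_relations R M N"
  obtains x x' y where "r = frag_of (x \<oplus>\<^bsub>M\<^esub> x', y) - frag_of (x, y) - frag_of (x', y)"
      "x \<in> carrier M" "x' \<in> carrier M" "y \<in> carrier N"
    | x y y' where "r = frag_of (x, y \<oplus>\<^bsub>N\<^esub> y') - frag_of (x, y) - frag_of (x, y')"
      "x \<in> carrier M" "y \<in> carrier N" "y' \<in> carrier N"
    | a x y where "r = frag_of (a \<odot>\<^bsub>M\<^esub> x, y) - frag_of (x, a \<odot>\<^bsub>N\<^esub> y)"
      "a \<in> carrier R" "x \<in> carrier M" "y \<in> carrier N"
  using assms unfolding tensor_relations_def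
  by (elim UnE CollectE exE conjE) (rule that; assumption)+

text \<open>Neither side is distinguished: \<open>M\<close> and \<open>N\<close> carry the same
  assumptions, so the results hold for a right and a left module in either order and survive
  exchanging the factors.\<close>

locale tensor_pair =
  fixes R :: "('r, 'b) ring_scheme" and M :: "('r, 'm, 'c) module_scheme"
    and N :: "('r, 'n, 'd) module_scheme"
  assumes abelian_M: "abelian_group M" and abelian_N: "abelian_group N"
    and smult_M: "\<lbrakk>a \<in> carrier R; x \<in> carrier M\<rbrakk> \<Longrightarrow> a \<odot>\<^bsub>M\<^esub> x \<in> carrier M"
    and smult_N: "\<lbrakk>a \<in> carrier R; y \<in> carrier N\<rbrakk> \<Longrightarrow> a \<odot>\<^bsub>N\<^esub> y \<in> carrier N"
begin

sublocale M: abelian_group M by (rule abelian_M)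
sublocale N: abelian_group N by (rule abelian_N)

lemma tensor_relations_keys:
  assumes "r \<in> tensor_relations R M N"
  shows "Poly_Mapping.keys r \<subseteq> carrier M \<times> carrier N"
  using assms unfolding tensor_relations_def
  by (auto simp: smult_M smult_N dest!: subsetD[OF keys_diff] split: if_splits)

lemma tensor_relations_subset:
  "tensor_relations R M N \<subseteq> carrier (free_Abelian_group (carrier M \<times> carrier N))"
  using tensor_relations_keys by auto

lemma subgroup_tensor_kernel:
  "subgroup (tensor_kernel R M N) (free_Abelian_group (carrier M \<times> carrier N))"
  unfolding tensor_kernel_def
  by (rule group.generate_is_subgroup[OF group_free_Abelian_group tensor_relations_subset])

lemma tensor_kernel_keys:
  assumes "c \<in> tensor_kernel R M N"
  shows "Poly_Mapping.keys c \<subseteq> carrier M \<times> carrier N"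
  using subgroup.subset[OF subgroup_tensor_kernel, THEN subsetD, OF assms] by simp

lemma tensor_kernel_zero: "0 \<in> tensor_kernel R M N"
  using subgroup.one_closed[OF subgroup_tensor_kernel] by simp

lemma tensor_kernel_add:
  assumes "a \<in> tensor_kernel R M N" "b \<in> tensor_kernel R M N"
  shows "a + b \<in> tensor_kernel R M N"
  using subgroup.m_closed[OF subgroup_tensor_kernel assms] by simp

lemma tensor_kernel_uminus:
  assumes "a \<in> tensor_kernel R M N"
  shows "- a \<in> tensor_kernel R M N"
  using subgroup.m_inv_closed[OF subgroup_tensor_kernel assms] tensor_kernel_keys[OF assms] by simp

lemma tensor_kernel_diff:
  assumes "a \<in> tensor_kernel R M N" "b \<in> tensor_kernel R M N"
  shows "a - b \<in> tensor_kernel R M N"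
  using tensor_kernel_add[OF assms(1) tensor_kernel_uminus[OF assms(2)]] by simp

lemma tensor_kernel_relation: "r \<in> tensor_relations R M N \<Longrightarrow> r \<in> tensor_kernel R M N"
  unfolding tensor_kernel_def by (rule generate.incl)

text \<open>Differences suffice as a closure rule, because an inverse is \<open>0 - h\<close> and a
  sum is \<open>h1 - (0 - h2)\<close>. Membership is proved along with \<open>P\<close>, so that the
  rule for differences can be applied at every stage.\<close>

lemma tensor_kernel_induct [consumes 1, case_names zero relation diff]:
  assumes c: "c \<in> tensor_kernel R M N"
    and zero: "P 0"
    and rel: "\<And>r. r \<in> tensor_relations R M N \<Longrightarrow> P r"
    and diff: "\<And>a b. \<lbrakk>a \<in> tensor_kernel R M N; b \<in> tensor_kernel R M N; P a; P b\<rbrakk> \<Longrightarrow> P (a - b)"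
  shows "P c"
proof -
  have "c \<in> tensor_kernel R M N \<and> P c"
    using c unfolding tensor_kernel_def
  proof (induction rule: generate.induct)
    case one
    then show ?case using zero tensor_kernel_zero by (simp add: tensor_kernel_def)
  next
    case (incl h)
    then show ?case using rel tensor_kernel_relation by (simp add: tensor_kernel_def)
  next
    case (inv h)
    then have "h \<in> tensor_kernel R M N" "P h"
      using rel tensor_kernel_relation by auto
    then show ?case
      using diff[OF tensor_kernel_zero, of h] zero tensor_kernel_uminus tensor_kernel_keys[of h]
      by (simp add: tensor_kernel_def)
  next
    case (eng h1 h2)
    then have "P (h1 - (0 - h2))"
      using zero diff tensor_kernel_diff tensor_kernel_zero unfolding tensor_kernel_def by blast
    then show ?case
      using eng tensor_kernel_add by (simp add: tensor_kernel_def)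
  qed
  then show ?thesis by simp
qed

section \<open>Elementary members of the kernel\<close>

lemma tensor_kernel_smult:
  assumes "a \<in> carrier R" "x \<in> carrier M" "y \<in> carrier N"
  shows "frag_of (a \<odot>\<^bsub>M\<^esub> x, y) - frag_of (x, a \<odot>\<^bsub>N\<^esub> y) \<in> tensor_kernel R M N"
  using assms by (intro tensor_kernel_relation) (auto simp: tensor_relations_def)

lemma tensor_kernel_add_left:
  assumes "x \<in> carrier M" "x' \<in> carrier M" "y \<in> carrier N"
  shows "frag_of (x \<oplus>\<^bsub>M\<^esub> x', y) - frag_of (x, y) - frag_of (x', y) \<in> tensor_kernel R M N"
  using assms by (intro tensor_kernel_relation) (auto simp: tensor_relations_def)

lemma tensor_kernel_add_right:
  assumes "x \<in> carrier M" "y \<in> carrier N" "y' \<in> carrier N"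
  shows "frag_of (x, y \<oplus>\<^bsub>N\<^esub> y') - frag_of (x, y) - frag_of (x, y') \<in> tensor_kernel R M N"
  using assms by (intro tensor_kernel_relation) (auto simp: tensor_relations_def)

text \<open>The additivity relation with both summands zero collapses to the negative of this
  generator.\<close>

lemma tensor_kernel_zero_left:
  assumes "y \<in> carrier N"
  shows "frag_of (\<zero>\<^bsub>M\<^esub>, y) \<in> tensor_kernel R M N"
  using tensor_kernel_uminus[OF tensor_kernel_add_left[of "\<zero>\<^bsub>M\<^esub>" "\<zero>\<^bsub>M\<^esub>" y]] assms by simp

lemma tensor_kernel_minus_left:
  assumes "x \<in> carrier M" "x' \<in> carrier M" "y \<in> carrier N"
  shows "frag_of (x, y) - frag_of (x', y) - frag_of (x \<ominus>\<^bsub>M\<^esub> x', y) \<in> tensor_kernel R M N"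
  using tensor_kernel_add_left[of "x \<ominus>\<^bsub>M\<^esub> x'" x' y] assms
  by (simp add: M.minus_eq M.a_assoc M.l_neg algebra_simps)

text \<open>\<open>tensor_map\<close> gathers the target cosets of the images of all
  representatives. Two representatives differ by an element of the kernel, whose image lies in the
  target kernel by \<open>ker\<close>, so only one coset arises and \<open>the_elem\<close> returns
  it.\<close>

lemma tensor_map_coset:
  assumes ker: "\<And>c. c \<in> tensor_kernel R M N \<Longrightarrow>
      frag_extend (\<lambda>(x, y). frag_of (f x, g y)) c \<in> tensor_kernel R M' N'"
    and "tensor_pair R M' N'"
    and f: "f \<in> carrier M \<rightarrow> carrier M'" and g: "g \<in> carrier N \<rightarrow> carrier N'"
    and c: "Poly_Mapping.keys c \<subseteq> carrier M \<times> carrier N"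
  shows "tensor_map R M' N' f g (tensor_kernel R M N #>\<^bsub>free_Abelian_group (carrier M \<times> carrier N)\<^esub> c) =
    tensor_kernel R M' N' #>\<^bsub>free_Abelian_group (carrier M' \<times> carrier N')\<^esub>
      frag_extend (\<lambda>(x, y). frag_of (f x, g y)) c"
proof -
  interpret T: tensor_pair R M' N' by fact
  let ?F = "frag_extend (\<lambda>(x, y). frag_of (f x, g y))"
  let ?G = "free_Abelian_group (carrier M \<times> carrier N)"
  let ?G' = "free_Abelian_group (carrier M' \<times> carrier N')"
  have keys: "Poly_Mapping.keys (?F c) \<subseteq> carrier M' \<times> carrier N'"
    if "Poly_Mapping.keys c \<subseteq> carrier M \<times> carrier N" for c
    by (rule order_trans[OF keys_frag_extend]) (use that f g in \<open>auto split: if_splits\<close>)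
  have "tensor_kernel R M' N' #>\<^bsub>?G'\<^esub> ?F b = tensor_kernel R M' N' #>\<^bsub>?G'\<^esub> ?F c"
    if b: "b \<in> tensor_kernel R M N #>\<^bsub>?G\<^esub> c" for b
  proof -
    obtain k where k: "k \<in> tensor_kernel R M N" "b = k + c"
      using b by (auto simp: r_coset_def)
    then have "?F b \<in> tensor_kernel R M' N' #>\<^bsub>?G'\<^esub> ?F c"
      using ker by (auto simp: r_coset_def frag_extend_add)
    then show ?thesis
      using group.repr_independence[OF group_free_Abelian_group _ _ T.subgroup_tensor_kernel] keys[OF c]
      by (metis carrier_free_Abelian_group_iff)
  qed
  moreover have "c \<in> tensor_kernel R M N #>\<^bsub>?G\<^esub> c"
    using c by (intro group.rcos_self subgroup_tensor_kernel) auto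
  ultimately show ?thesis
    unfolding tensor_map_def by (intro the_elem_image_unique) blast+
qed

text \<open>Reduces injectivity on cosets to elements of the free abelian group: one direction of
  \<open>ker\<close> makes the map well defined on cosets, the other is applied to the difference of
  two representatives with equal image.\<close>

lemma inj_on_tensor_map:
  assumes ker: "\<And>c. Poly_Mapping.keys c \<subseteq> carrier M \<times> carrier N \<Longrightarrow>
      frag_extend (\<lambda>(x, y). frag_of (f x, g y)) c \<in> tensor_kernel R M' N' \<longleftrightarrow>
      c \<in> tensor_kernel R M N"
    and T: "tensor_pair R M' N'"
    and f: "f \<in> carrier M \<rightarrow> carrier M'" and g: "g \<in> carrier N \<rightarrow> carrier N'"
  shows "inj_on (tensor_map R M' N' f g) (carrier (tensor_product R M N))"
proof (rule inj_onI)
  interpret T: tensor_pair R M' N' by fact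
  let ?F = "frag_extend (\<lambda>(x, y). frag_of (f x, g y))"
  let ?G = "free_Abelian_group (carrier M \<times> carrier N)"
  let ?G' = "free_Abelian_group (carrier M' \<times> carrier N')"
  have keys: "Poly_Mapping.keys (?F c) \<subseteq> carrier M' \<times> carrier N'"
    if "Poly_Mapping.keys c \<subseteq> carrier M \<times> carrier N" for c
    by (rule order_trans[OF keys_frag_extend]) (use that f g in \<open>auto split: if_splits\<close>)
  fix A B
  assume A: "A \<in> carrier (tensor_product R M N)" and B: "B \<in> carrier (tensor_product R M N)"
    and eq: "tensor_map R M' N' f g A = tensor_map R M' N' f g B"
  obtain a where a: "Poly_Mapping.keys a \<subseteq> carrier M \<times> carrier N" "A = tensor_kernel R M N #>\<^bsub>?G\<^esub> a"
    using A by (auto simp: tensor_product_def FactGroup_def RCOSETS_def)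
  obtain b where b: "Poly_Mapping.keys b \<subseteq> carrier M \<times> carrier N" "B = tensor_kernel R M N #>\<^bsub>?G\<^esub> b"
    using B by (auto simp: tensor_product_def FactGroup_def RCOSETS_def)
  have "tensor_kernel R M' N' #>\<^bsub>?G'\<^esub> ?F a = tensor_kernel R M' N' #>\<^bsub>?G'\<^esub> ?F b"
    using eq a b ker tensor_map_coset[OF _ T f g] tensor_kernel_keys by metis
  then have "?F a \<in> tensor_kernel R M' N' #>\<^bsub>?G'\<^esub> ?F b"
    using group.rcos_self[OF group_free_Abelian_group _ T.subgroup_tensor_kernel, of "?F a"] keys[OF a(1)]
    by simp
  then have "?F a - ?F b \<in> tensor_kernel R M' N'"
    by (auto simp: r_coset_def)
  moreover have keys_diff': "Poly_Mapping.keys (a - b) \<subseteq> carrier M \<times> carrier N"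
    using keys_diff[of a b] a b by blast
  ultimately have "a - b \<in> tensor_kernel R M N"
    using ker[of "a - b"] by (simp add: frag_extend_diff)
  then have "a \<in> tensor_kernel R M N #>\<^bsub>?G\<^esub> b"
    unfolding r_coset_def by (auto intro!: bexI[of _ "a - b"])
  then show "A = B"
    using group.repr_independence[OF group_free_Abelian_group _ _ subgroup_tensor_kernel] a b
    by (metis carrier_free_Abelian_group_iff)
qed

end

text \<open>Each of the three kinds of relation is carried to a relation of the same kind, by
  additivity of \<open>f\<close>, additivity of \<open>g\<close>, and compatibility of both with
  scalars.\<close>

lemma tensor_kernel_image:
  assumes T: "tensor_pair R M N" and T': "tensor_pair R M' N'"
    and f: "f \<in> linear_maps R M M'" and g: "g \<in> linear_maps R N N'"
    and c: "c \<in> tensor_kernel R M N"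
  shows "frag_extend (\<lambda>(x, y). frag_of (f x, g y)) c \<in> tensor_kernel R M' N'"
proof -
  interpret T: tensor_pair R M N by fact
  interpret T': tensor_pair R M' N' by fact
  have f': "f x \<in> carrier M'" if "x \<in> carrier M" for x
    using that f by (auto simp: linear_maps_def hom_def)
  have g': "g y \<in> carrier N'" if "y \<in> carrier N" for y
    using that g by (auto simp: linear_maps_def hom_def)
  show ?thesis
    using c
  proof (induction rule: T.tensor_kernel_induct)
    case zero
    then show ?case by (simp add: T'.tensor_kernel_zero)
  next
    case (relation r)
    then show ?case
    proof (cases rule: tensor_relationsE)
      case (add_left x x' y)
      then show ?thesis
        using f T'.tensor_kernel_add_left[of "f x" "f x'" "g y"]
        by (simp add: frag_extend_diff f' g' linear_maps_def hom_def)
    next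
      case (add_right x y y')
      then show ?thesis
        using g T'.tensor_kernel_add_right[of "f x" "g y" "g y'"]
        by (simp add: frag_extend_diff f' g' linear_maps_def hom_def)
    next
      case (smult a x y)
      then show ?thesis
        using f g T'.tensor_kernel_smult[of a "f x" "g y"]
        by (simp add: frag_extend_diff f' g' linear_maps_def)
    qed
  next
    case (diff a b)
    then show ?case by (simp add: frag_extend_diff T'.tensor_kernel_diff)
  qed
qed

section \<open>Directed unions of principal projective modules\<close>

lemma tensor_pair_right_left:
  "right_module R M \<Longrightarrow> left_module R N \<Longrightarrow> tensor_pair R M N"
  by (intro tensor_pair.intro)
    (auto simp: right_module_def left_module_def right_module_axioms_def left_module_axioms_def)

lemma tensor_pair_left_right:
  "left_module R M \<Longrightarrow> right_module R N \<Longrightarrow> tensor_pair R M N"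
  by (intro tensor_pair.intro)
    (auto simp: right_module_def left_module_def right_module_axioms_def left_module_axioms_def)

lemma id_linear_maps: "id \<in> linear_maps R M M"
  by (auto simp: linear_maps_def hom_def)

text \<open>The value of a homomorphism on an additivity relation has this shape once its first
  generator has been expanded.\<close>

lemma abelian_group_add_diff_diff:
  assumes "abelian_group G" "x \<in> carrier G" "y \<in> carrier G"
  shows "(x \<oplus>\<^bsub>G\<^esub> y) \<ominus>\<^bsub>G\<^esub> x \<ominus>\<^bsub>G\<^esub> y = \<zero>\<^bsub>G\<^esub>"
proof -
  interpret abelian_group G by fact
  have "(x \<oplus>\<^bsub>G\<^esub> y) \<ominus>\<^bsub>G\<^esub> x \<ominus>\<^bsub>G\<^esub> y = (x \<oplus>\<^bsub>G\<^esub> y) \<ominus>\<^bsub>G\<^esub> (x \<oplus>\<^bsub>G\<^esub> y)"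
    using assms by (simp add: minus_eq minus_add a_assoc)
  then show ?thesis
    using assms by (simp add: minus_eq r_neg)
qed

text \<open>Eventually along \<open>F\<close>, an element of \<open>M\<close> lies in the principal submodule generated by \<open>d i\<close>,
  and \<open>q i\<close> chooses its coefficient linearly.\<close>

locale module_coordinates = left_module R M for R (structure) and M (structure) +
  fixes F :: "'i filter" and d :: "'i \<Rightarrow> 'm" and q :: "'i \<Rightarrow> 'm \<Rightarrow> 'r"
  assumes F_nontrivial: "F \<noteq> bot"
    and coordinate_add: "\<lbrakk>A \<in> carrier M; B \<in> carrier M\<rbrakk> \<Longrightarrow>
      q i (A \<oplus>\<^bsub>M\<^esub> B) = q i A \<oplus>\<^bsub>R\<^esub> q i B"
    and coordinate_smult: "\<lbrakk>a \<in> carrier R; A \<in> carrier M\<rbrakk> \<Longrightarrow>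
      q i (a \<odot>\<^bsub>M\<^esub> A) = a \<otimes>\<^bsub>R\<^esub> q i A"
    and eventually_coordinate: "A \<in> carrier M \<Longrightarrow>
      eventually (\<lambda>i. d i \<in> carrier M \<and> q i A \<in> carrier R \<and> q i A \<odot>\<^bsub>M\<^esub> d i = A) F"
begin

text \<open>For a fixed \<open>i\<close> the tensor relations need not be respected, so the map is
  defined on the free abelian group and not on the tensor product. Zero is a filler for coefficients
  that lie outside \<open>R\<close>.\<close>

definition coordinate_hom :: "('r, 'k, 'z) module_scheme \<Rightarrow> 'i \<Rightarrow> ('k \<times> 'm \<Rightarrow>\<^sub>0 int) \<Rightarrow> 'k" where
  "coordinate_hom K i = (SOME h. h \<in> hom (free_Abelian_group (carrier K \<times> carrier M)) (add_monoid K) \<and>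
     (\<forall>k \<in> carrier K. \<forall>A \<in> carrier M.
        h (frag_of (k, A)) = (if q i A \<in> carrier R then q i A \<odot>\<^bsub>K\<^esub> k else \<zero>\<^bsub>K\<^esub>)))"

context
  fixes K :: "('r, 'k, 'z) module_scheme"
  assumes K: "right_module R K"
begin

interpretation K: right_module R K by (rule K)

interpretation T: tensor_pair R K M
  by (rule tensor_pair_right_left[OF K left_module_axioms])

lemma coordinate_hom:
  "coordinate_hom K i \<in> hom (free_Abelian_group (carrier K \<times> carrier M)) (add_monoid K)"
  and coordinate_hom_of: "\<lbrakk>k \<in> carrier K; A \<in> carrier M\<rbrakk> \<Longrightarrow>
    coordinate_hom K i (frag_of (k, A)) = (if q i A \<in> carrier R then q i A \<odot>\<^bsub>K\<^esub> k else \<zero>\<^bsub>K\<^esub>)"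
proof -
  let ?\<phi> = "\<lambda>(k, A). if q i A \<in> carrier R then q i A \<odot>\<^bsub>K\<^esub> k else \<zero>\<^bsub>K\<^esub>"
  \<comment> \<open>The filler value keeps \<open>?\<phi>\<close> inside the carrier of
    \<open>K\<close>, as the universal property of the free abelian group requires.\<close>
  have "?\<phi> ` (carrier K \<times> carrier M) \<subseteq> carrier (add_monoid K)"
    by (auto simp: K.smult_closed)
  then obtain h where "h \<in> hom (free_Abelian_group (carrier K \<times> carrier M)) (add_monoid K)"
      "\<And>x. x \<in> carrier K \<times> carrier M \<Longrightarrow> h (frag_of x) = ?\<phi> x"
    by (rule comm_group.free_Abelian_group_universal[OF K.a_comm_group]) (rule that)
  then have "\<exists>h. h \<in> hom (free_Abelian_group (carrier K \<times> carrier M)) (add_monoid K) \<and>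
     (\<forall>k \<in> carrier K. \<forall>A \<in> carrier M.
        h (frag_of (k, A)) = (if q i A \<in> carrier R then q i A \<odot>\<^bsub>K\<^esub> k else \<zero>\<^bsub>K\<^esub>))"
    by (intro exI[of _ h] conjI ballI) simp_all
  from someI_ex[OF this, folded coordinate_hom_def]
  show "coordinate_hom K i \<in> hom (free_Abelian_group (carrier K \<times> carrier M)) (add_monoid K)"
    and "\<lbrakk>k \<in> carrier K; A \<in> carrier M\<rbrakk> \<Longrightarrow>
      coordinate_hom K i (frag_of (k, A)) = (if q i A \<in> carrier R then q i A \<odot>\<^bsub>K\<^esub> k else \<zero>\<^bsub>K\<^esub>)"
    by auto
qed

lemma coordinate_hom_closed:
  assumes "Poly_Mapping.keys c \<subseteq> carrier K \<times> carrier M"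
  shows "coordinate_hom K i c \<in> carrier K"
  using hom_in_carrier[OF coordinate_hom] assms by simp

lemma coordinate_hom_zero: "coordinate_hom K i 0 = \<zero>\<^bsub>K\<^esub>"
  using hom_one[OF coordinate_hom group_free_Abelian_group K.a_group] by simp

lemma coordinate_hom_diff:
  assumes a: "Poly_Mapping.keys a \<subseteq> carrier K \<times> carrier M"
    and b: "Poly_Mapping.keys b \<subseteq> carrier K \<times> carrier M"
  shows "coordinate_hom K i (a - b) = coordinate_hom K i a \<ominus>\<^bsub>K\<^esub> coordinate_hom K i b"
proof -
  have ab: "Poly_Mapping.keys (a - b) \<subseteq> carrier K \<times> carrier M"
    using keys_diff[of a b] a b by blast
  then have "coordinate_hom K i ((a - b) + b) = coordinate_hom K i (a - b) \<oplus>\<^bsub>K\<^esub> coordinate_hom K i b"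
    using hom_mult[OF coordinate_hom, of "a - b" b] b by simp
  then show ?thesis
    using coordinate_hom_closed[OF ab] coordinate_hom_closed[OF b]
    by (simp add: K.minus_eq K.a_assoc K.r_neg)
qed

text \<open>An element of the kernel is built from finitely many relations. Each is sent to zero as
  soon as the coefficients of one or two elements of \<open>M\<close> lie in \<open>R\<close>, and
  finitely many such conditions hold eventually together.\<close>

lemma eventually_coordinate_hom_zero:
  assumes "c \<in> tensor_kernel R K M"
  shows "eventually (\<lambda>i. coordinate_hom K i c = \<zero>\<^bsub>K\<^esub>) F"
  using assms
proof (induction rule: T.tensor_kernel_induct)
  case zero
  then show ?case by (simp add: coordinate_hom_zero)
next
  case (relation r)
  then show ?case
  proof (cases rule: tensor_relationsE)
    case (add_left x x' A)
    have "coordinate_hom K i r = \<zero>\<^bsub>K\<^esub>" if "q i A \<in> carrier R" for i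
      using that add_left
      by (simp add: coordinate_hom_diff coordinate_hom_of K.smult_r_distr
          K.smult_closed abelian_group_add_diff_diff[OF K.abelian_group_axioms] subset_trans[OF keys_diff])
    then show ?thesis
      using eventually_coordinate[OF add_left(4)] by (auto elim: eventually_mono)
  next
    case (add_right x A B)
    \<comment> \<open>The coefficient of \<open>A \<oplus> B\<close> is the sum of two coefficients
      in \<open>R\<close>, so it lies in \<open>R\<close> as well and the filler does not
      enter.\<close>
    have "coordinate_hom K i r = \<zero>\<^bsub>K\<^esub>" if "q i A \<in> carrier R" "q i B \<in> carrier R" for i
      using that add_right
      by (simp add: coordinate_hom_diff coordinate_hom_of coordinate_add K.smult_l_distr
          K.smult_closed abelian_group_add_diff_diff[OF K.abelian_group_axioms] subset_trans[OF keys_diff])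
    then show ?thesis
      using eventually_conj[OF eventually_coordinate[OF add_right(3)] eventually_coordinate[OF add_right(4)]]
      by (auto elim: eventually_mono)
  next
    case (smult a x A)
    \<comment> \<open>Both terms become \<open>x\<close> multiplied by \<open>a\<close> and then by
      the coefficient of \<open>A\<close>; for the second term this is
      \<open>coordinate_smult\<close> together with the associativity law of a right module.\<close>
    have "coordinate_hom K i r = \<zero>\<^bsub>K\<^esub>" if "q i A \<in> carrier R" for i
      using that smult
      by (simp add: coordinate_hom_diff coordinate_hom_of coordinate_smult K.smult_assoc
          K.smult_closed smult_closed K.minus_eq K.r_neg)
    then show ?thesis
      using eventually_coordinate[OF smult(4)] by (auto elim: eventually_mono)
  qed
next
  case (diff a b)
  then have "eventually (\<lambda>i. coordinate_hom K i a = \<zero>\<^bsub>K\<^esub> \<and> coordinate_hom K i b = \<zero>\<^bsub>K\<^esub>) F"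
    by (intro eventually_conj)
  then show ?case
    by (rule eventually_mono)
      (simp add: coordinate_hom_diff T.tensor_kernel_keys diff.hyps K.minus_eq)
qed

text \<open>Once \<open>A\<close> equals its coefficient times \<open>d i\<close>, that coefficient
  can be moved across the tensor sign. All terms then share the second factor \<open>d i\<close> and
  add up, so eventually \<open>c\<close> represents one pure tensor.\<close>

lemma eventually_coordinate_hom_tensor:
  assumes "Poly_Mapping.keys c \<subseteq> carrier K \<times> carrier M"
  shows "eventually (\<lambda>i. d i \<in> carrier M \<and> c - frag_of (coordinate_hom K i c, d i) \<in> tensor_kernel R K M) F"
proof -
  have "Poly_Mapping.keys c \<subseteq> carrier K \<times> carrier M \<and>
    eventually (\<lambda>i. d i \<in> carrier M \<and> c - frag_of (coordinate_hom K i c, d i) \<in> tensor_kernel R K M) F"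
    using assms
  proof (induction rule: frag_induction)
    case zero
    then show ?case
      \<comment> \<open>Membership of \<open>d i\<close> in \<open>M\<close> is part of the claim
        even for \<open>0\<close>, and is drawn from the eventual property of the zero
        element.\<close>
      using eventually_coordinate[OF zero_closed]
      by (auto elim!: eventually_mono simp: coordinate_hom_zero
          intro!: T.tensor_kernel_uminus T.tensor_kernel_zero_left)
  next
    case (one x)
    then obtain k A where x: "x = (k, A)" "k \<in> carrier K" "A \<in> carrier M"
      by auto
    have "d i \<in> carrier M \<and> frag_of x - frag_of (coordinate_hom K i (frag_of x), d i) \<in> tensor_kernel R K M"
      if "d i \<in> carrier M \<and> q i A \<in> carrier R \<and> q i A \<odot>\<^bsub>M\<^esub> d i = A" for i
      using that x T.tensor_kernel_uminus[OF T.tensor_kernel_smult[of "q i A" k "d i"]]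
      by (simp add: coordinate_hom_of)
    then show ?case
      using eventually_coordinate[OF x(3)] one by (auto elim: eventually_mono)
  next
    case (diff a b)
    have "d i \<in> carrier M \<and> a - b - frag_of (coordinate_hom K i (a - b), d i) \<in> tensor_kernel R K M"
      if "d i \<in> carrier M \<and> a - frag_of (coordinate_hom K i a, d i) \<in> tensor_kernel R K M"
        "d i \<in> carrier M \<and> b - frag_of (coordinate_hom K i b, d i) \<in> tensor_kernel R K M" for i
    proof -
      \<comment> \<open>The added correction replaces the difference of two tensors with second
        factor \<open>d i\<close> by the tensor of the difference.\<close>
      have "(a - frag_of (coordinate_hom K i a, d i)) - (b - frag_of (coordinate_hom K i b, d i))
          + (frag_of (coordinate_hom K i a, d i) - frag_of (coordinate_hom K i b, d i)
            - frag_of (coordinate_hom K i a \<ominus>\<^bsub>K\<^esub> coordinate_hom K i b, d i)) \<in> tensor_kernel R K M"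
        using that diff
        by (intro T.tensor_kernel_add[OF T.tensor_kernel_diff T.tensor_kernel_minus_left] coordinate_hom_closed)
          auto
      then show ?thesis
        using that diff by (simp add: coordinate_hom_diff algebra_simps)
    qed
    then show ?case
      using diff keys_diff[of a b] eventually_elim2 by (smt (verit) Un_iff in_mono subsetI)
  qed
  then show ?thesis by simp
qed

end

text \<open>At one index \<open>i\<close> where both eventual statements hold, \<open>f\<close>
  sends the coordinate of \<open>c\<close> to zero because the image of \<open>c\<close> is in the
  kernel. Injectivity makes the coordinate itself zero, and \<open>c\<close> is equivalent to zero
  tensored with \<open>d i\<close>.\<close>

lemma tensor_kernel_reflect:
  assumes K: "right_module R K" and L: "right_module R L"
    and f: "f \<in> linear_maps R K L" "inj_on f (carrier K)"
    and c: "Poly_Mapping.keys (c :: _ \<Rightarrow>\<^sub>0 int) \<subseteq> carrier K \<times> carrier M"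
    and fc: "frag_extend (\<lambda>(x, y). frag_of (f x, id y)) c \<in> tensor_kernel R L M"
  shows "c \<in> tensor_kernel R K M"
proof -
  interpret K: right_module R K by fact
  interpret L: right_module R L by fact
  interpret T: tensor_pair R K M
    by (rule tensor_pair_right_left[OF K left_module_axioms])
  let ?F = "frag_extend (\<lambda>(x, y). frag_of (f x, id y))"
  have f': "f x \<in> carrier L" if "x \<in> carrier K" for x
    using that f by (auto simp: linear_maps_def hom_def)
  have fh: "f \<in> hom (add_monoid K) (add_monoid L)"
    using f by (simp add: linear_maps_def)
  interpret f: group_hom "add_monoid K" "add_monoid L" f
    using fh by (simp add: group_hom_def group_hom_axioms_def K.a_group L.a_group)
  have f_diff: "f (x \<ominus>\<^bsub>K\<^esub> y) = f x \<ominus>\<^bsub>L\<^esub> f y" if "x \<in> carrier K" "y \<in> carrier K" for x y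
    using that f.hom_inv[of y] f.hom_mult[of x "\<ominus>\<^bsub>K\<^esub> y"]
    by (simp add: a_minus_def a_inv_def)
  have f_zero: "f \<zero>\<^bsub>K\<^esub> = \<zero>\<^bsub>L\<^esub>"
    using f.hom_one by simp
  \<comment> \<open>Coordinates are natural in \<open>K\<close> at every \<open>i\<close>, since
    \<open>f\<close> commutes with scalars and sends the filler zero to zero. The support bounds are
    carried along because the rule for differences requires them.\<close>
  have "Poly_Mapping.keys c \<subseteq> carrier K \<times> carrier M \<and> Poly_Mapping.keys (?F c) \<subseteq> carrier L \<times> carrier M \<and>
      coordinate_hom L i (?F c) = f (coordinate_hom K i c)" for i
    using c
  proof (induction rule: frag_induction)
    case zero
    then show ?case
      by (simp add: coordinate_hom_zero K L f_zero)
  next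
    case (one x)
    then show ?case
      using f by (auto simp: coordinate_hom_of K L f' f_zero linear_maps_def)
  next
    case (diff a b)
    moreover have "Poly_Mapping.keys (a - b) \<subseteq> carrier K \<times> carrier M"
        "Poly_Mapping.keys (?F a - ?F b) \<subseteq> carrier L \<times> carrier M"
      using diff keys_diff[of a b] keys_diff[of "?F a" "?F b"] by blast+
    ultimately show ?case
      by (simp add: coordinate_hom_diff K L f_diff coordinate_hom_closed frag_extend_diff)
  qed
  then have eq: "coordinate_hom L i (?F c) = f (coordinate_hom K i c)" for i
    by blast
  have "eventually (\<lambda>i. coordinate_hom L i (?F c) = \<zero>\<^bsub>L\<^esub> \<and>
      d i \<in> carrier M \<and> c - frag_of (coordinate_hom K i c, d i) \<in> tensor_kernel R K M) F"
    by (intro eventually_conj eventually_coordinate_hom_zero eventually_coordinate_hom_tensor K L c fc)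
  from eventually_happens'[OF F_nontrivial this]
  obtain i where i: "f (coordinate_hom K i c) = \<zero>\<^bsub>L\<^esub>"
      "d i \<in> carrier M" "c - frag_of (coordinate_hom K i c, d i) \<in> tensor_kernel R K M"
    unfolding eq by blast
  have "coordinate_hom K i c = \<zero>\<^bsub>K\<^esub>"
    by (rule inj_onD[OF f(2)]) (simp_all add: i f_zero coordinate_hom_closed[OF K c])
  then show ?thesis
    using T.tensor_kernel_add[OF i(3) T.tensor_kernel_zero_left[OF i(2)]] by simp
qed

lemma flat: "flat_left_module TYPE('k) TYPE('l) R M"
  unfolding flat_left_module_def
proof (intro conjI allI impI left_module_axioms)
  fix K :: "('r, 'k) module" and L :: "('r, 'l) module" and f
  assume "right_module R K \<and> right_module R L \<and> f \<in> linear_maps R K L \<and> inj_on f (carrier K)"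
  then have K: "right_module R K" and L: "right_module R L" and f: "f \<in> linear_maps R K L" "inj_on f (carrier K)"
    by auto
  have TK: "tensor_pair R K M" and TL: "tensor_pair R L M"
    using K L left_module_axioms by (auto intro: tensor_pair_right_left)
  show "inj_on (tensor_map R L M f id) (carrier (tensor_product R K M))"
  proof (rule tensor_pair.inj_on_tensor_map[OF TK _ TL])
    fix c :: "'k \<times> 'm \<Rightarrow>\<^sub>0 int"
    assume "Poly_Mapping.keys c \<subseteq> carrier K \<times> carrier M"
    then show "frag_extend (\<lambda>(x, y). frag_of (f x, id y)) c \<in> tensor_kernel R L M \<longleftrightarrow> c \<in> tensor_kernel R K M"
      using tensor_kernel_reflect[OF K L f] tensor_kernel_image[OF TK TL f(1) id_linear_maps] by blast
  qed (use f in \<open>auto simp: linear_maps_def hom_def\<close>)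
qed

end

section \<open>Exchanging left and right\<close>

text \<open>Right and left actions share the format \<open>smult M a x\<close>, so reversing the
  product turns a right module into a left module without touching the module record.\<close>

definition opposite_ring :: "('r, 'b) ring_scheme \<Rightarrow> 'r ring" where
  "opposite_ring R = \<lparr>carrier = carrier R, mult = (\<lambda>a b. b \<otimes>\<^bsub>R\<^esub> a), one = \<one>\<^bsub>R\<^esub>,
     ring.zero = \<zero>\<^bsub>R\<^esub>, add = add R\<rparr>"

lemma opposite_ring_simps [simp]:
  "carrier (opposite_ring R) = carrier R"
  "a \<otimes>\<^bsub>opposite_ring R\<^esub> b = b \<otimes>\<^bsub>R\<^esub> a"
  "\<one>\<^bsub>opposite_ring R\<^esub> = \<one>\<^bsub>R\<^esub>"
  "\<zero>\<^bsub>opposite_ring R\<^esub> = \<zero>\<^bsub>R\<^esub>"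
  "a \<oplus>\<^bsub>opposite_ring R\<^esub> b = a \<oplus>\<^bsub>R\<^esub> b"
  by (simp_all add: opposite_ring_def)

lemma ring_opposite_ring:
  assumes "ring R"
  shows "ring (opposite_ring R)"
proof -
  interpret ring R by fact
  show ?thesis
    by (intro ringI abelian_groupI monoidI)
      (auto simp: a_assoc m_assoc l_distr r_distr intro: a_comm l_neg a_inv_closed)
qed

lemma left_module_opposite_ring:
  assumes "right_module R M"
  shows "left_module (opposite_ring R) M"
proof -
  interpret right_module R M by fact
  show ?thesis
    by (intro left_module.intro left_module_axioms.intro ring_opposite_ring)
      (simp_all add: ring_axioms M.abelian_group_axioms smult_closed smult_l_distr smult_r_distr
        smult_assoc smult_one)
qed

lemma right_module_opposite_ring:
  assumes "left_module R M"
  shows "right_module (opposite_ring R) M"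
proof -
  interpret left_module R M by fact
  show ?thesis
    by (intro right_module.intro right_module_axioms.intro ring_opposite_ring)
      (simp_all add: ring_axioms M.abelian_group_axioms smult_closed smult_l_distr smult_r_distr
        smult_assoc smult_one)
qed

lemma linear_maps_opposite_ring [simp]: "linear_maps (opposite_ring R) M N = linear_maps R M N"
  by (simp add: linear_maps_def)

text \<open>The tensor relations see only the carrier of the ring and the two actions, never the
  product of the ring.\<close>

lemma tensor_kernel_opposite_ring [simp]:
  "tensor_kernel (opposite_ring R) M N = tensor_kernel R M N"
  by (simp add: tensor_kernel_def tensor_relations_def)

abbreviation frag_swap :: "('x \<times> 'y \<Rightarrow>\<^sub>0 int) \<Rightarrow> ('y \<times> 'x \<Rightarrow>\<^sub>0 int)" where
  "frag_swap \<equiv> frag_extend (\<lambda>(x, y). frag_of (y, x))"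

lemma frag_swap_extend:
  "frag_swap (frag_extend (\<lambda>(x, y). frag_of (f x, g y)) c) =
     frag_extend (\<lambda>(y, x). frag_of (g y, f x)) (frag_swap c)"
  by (induction c rule: frag_induction[OF subset_UNIV]) (auto simp: frag_extend_diff)

lemma frag_swap_swap: "frag_swap (frag_swap c) = c"
  by (induction c rule: frag_induction[OF subset_UNIV]) (auto simp: frag_extend_diff)

text \<open>Exchanging the factors interchanges the two additivity relations and turns a scalar
  relation into the negative of one.\<close>

lemma frag_swap_tensor_kernel:
  assumes T: "tensor_pair R M N" and c: "c \<in> tensor_kernel R M N"
  shows "frag_swap c \<in> tensor_kernel R N M"
proof -
  interpret T: tensor_pair R M N by fact
  interpret T': tensor_pair R N M
    using T by (auto simp: tensor_pair_def)
  show ?thesis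
    using c
  proof (induction rule: T.tensor_kernel_induct)
    case zero
    then show ?case by (simp add: T'.tensor_kernel_zero)
  next
    case (relation r)
    then show ?case
    proof (cases rule: tensor_relationsE)
      case (add_left x x' y)
      then show ?thesis
        using T'.tensor_kernel_add_right[of y x x'] by (simp add: frag_extend_diff)
    next
      case (add_right x y y')
      then show ?thesis
        using T'.tensor_kernel_add_left[of y y' x] by (simp add: frag_extend_diff)
    next
      case (smult a x y)
      then show ?thesis
        using T'.tensor_kernel_uminus[OF T'.tensor_kernel_smult[of a y x]] by (simp add: frag_extend_diff)
    qed
  next
    case (diff a b)
    then show ?case by (simp add: frag_extend_diff T'.tensor_kernel_diff)
  qed
qed

text \<open>Over the opposite ring the test modules become right modules, so after exchanging the
  factors \<open>tensor_kernel_reflect\<close> applies; exchanging once more returns to the original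
  tensor product.\<close>

lemma flat_right_module_coordinates:
  assumes M: "right_module R M" and "module_coordinates (opposite_ring R) M F d q"
  shows "flat_right_module TYPE('k) TYPE('l) R M"
  unfolding flat_right_module_def
proof (intro conjI allI impI M)
  interpret C: module_coordinates "opposite_ring R" M F d q by fact
  fix K :: "('a, 'k) module" and L :: "('a, 'l) module" and f
  assume "left_module R K \<and> left_module R L \<and> f \<in> linear_maps R K L \<and> inj_on f (carrier K)"
  then have K: "left_module R K" and L: "left_module R L" and f: "f \<in> linear_maps R K L" "inj_on f (carrier K)"
    by auto
  have T: "tensor_pair R M K" "tensor_pair R M L" "tensor_pair R K M"
    using K L M by (auto intro: tensor_pair_right_left tensor_pair_left_right)
  show "inj_on (tensor_map R M L id f) (carrier (tensor_product R M K))"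
  proof (rule tensor_pair.inj_on_tensor_map[OF T(1) _ T(2)])
    fix c :: "'c \<times> 'k \<Rightarrow>\<^sub>0 int"
    assume c: "Poly_Mapping.keys c \<subseteq> carrier M \<times> carrier K"
    have "c \<in> tensor_kernel R M K"
      if "frag_extend (\<lambda>(x, y). frag_of (id x, f y)) c \<in> tensor_kernel R M L"
    proof -
      have "frag_extend (\<lambda>(y, x). frag_of (f y, id x)) (frag_swap c) \<in> tensor_kernel R L M"
        using frag_swap_tensor_kernel[OF T(2) that] by (simp add: frag_swap_extend)
      moreover have "Poly_Mapping.keys (frag_swap c) \<subseteq> carrier K \<times> carrier M"
        by (rule order_trans[OF keys_frag_extend]) (use c in \<open>auto split: if_splits\<close>)
      ultimately have "frag_swap c \<in> tensor_kernel R K M"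
        using C.tensor_kernel_reflect[of K L f "frag_swap c"] f right_module_opposite_ring[OF K]
          right_module_opposite_ring[OF L] by simp
      then show ?thesis
        using frag_swap_tensor_kernel[OF T(3)] by (metis frag_swap_swap)
    qed
    then show "frag_extend (\<lambda>(x, y). frag_of (id x, f y)) c \<in> tensor_kernel R M L \<longleftrightarrow> c \<in> tensor_kernel R M K"
      using tensor_kernel_image[OF T(1,2) id_linear_maps f(1)] by blast
  qed (use f in \<open>auto simp: linear_maps_def hom_def\<close>)
qed

section \<open>Symmetric ideals and domination\<close>

context
  fixes S :: "(nat \<Rightarrow> complex) set"
  assumes S: "symmetric_ideal S"
begin

interpretation ideal S linf_ring
  using S by (simp add: symmetric_ideal_def)

lemma symmetric_ideal_zero: "(\<lambda>n. 0) \<in> S"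
  using additive_subgroup.zero_closed[OF is_additive_subgroup] by (simp add: linf_ring_def)

lemma symmetric_ideal_add: "\<alpha> \<in> S \<Longrightarrow> \<beta> \<in> S \<Longrightarrow> (\<lambda>n. \<alpha> n + \<beta> n) \<in> S"
  using additive_subgroup.a_closed[OF is_additive_subgroup, of \<alpha> \<beta>] by (simp add: linf_ring_def)

lemma symmetric_ideal_bounded: "\<alpha> \<in> S \<Longrightarrow> bounded (range \<alpha>)"
  using additive_subgroup.a_subset[OF is_additive_subgroup] by (auto simp: linf_ring_def linf_def)

text \<open>The quotient of \<open>\<beta>\<close> by \<open>\<alpha>\<close> is a bounded sequence,
  and multiplying \<open>\<alpha>\<close> by it stays in the ideal. At a zero of
  \<open>\<alpha>\<close> the bound forces \<open>\<beta>\<close> to vanish, so division by zero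
  does no harm.\<close>

lemma symmetric_ideal_le:
  assumes \<alpha>: "\<alpha> \<in> S" and le: "\<And>n. cmod (\<beta> n) \<le> C * cmod (\<alpha> n)"
  shows "\<beta> \<in> S"
proof -
  have "cmod (\<beta> n / \<alpha> n) \<le> \<bar>C\<bar>" for n
  proof (cases "\<alpha> n = 0")
    case False
    have "cmod (\<beta> n) \<le> \<bar>C\<bar> * cmod (\<alpha> n)"
      using le[of n] by (smt (verit) mult_right_mono norm_ge_zero)
    with False show ?thesis by (simp add: norm_divide divide_simps)
  qed simp
  moreover define \<gamma> where "\<gamma> n = \<beta> n / \<alpha> n" for n
  ultimately have "\<gamma> \<in> carrier linf_ring"
    unfolding linf_ring_def linf_def by (auto simp: bounded_iff)
  then have "(\<lambda>n. \<gamma> n * \<alpha> n) \<in> S"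
    using I_l_closed[OF \<alpha>] by (simp add: linf_ring_def)
  moreover have "(\<lambda>n. \<gamma> n * \<alpha> n) = \<beta>"
    using le by (auto simp: \<gamma>_def fun_eq_iff) (metis mult_zero_right norm_le_zero_iff norm_zero)
  ultimately show ?thesis by simp
qed

lemma symmetric_ideal_sum:
  assumes "\<And>k. \<beta> k \<in> S"
  shows "(\<lambda>n. \<Sum>k<(m::nat). \<beta> k n) \<in> S"
  by (induction m) (simp_all add: symmetric_ideal_zero symmetric_ideal_add assms)

text \<open>Splitting the support of \<open>\<beta>\<close> by the rank of a point inside its fibre makes \<open>g\<close> injective on
  each of the \<open>K\<close> pieces.\<close>

lemma symmetric_ideal_dominated:
  fixes g :: "nat \<Rightarrow> nat"
  assumes \<alpha>: "\<alpha> \<in> S" and le: "\<And>n. cmod (\<beta> n) \<le> C * cmod (\<alpha> (g n))"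
    and fin: "\<And>m. finite {n. \<beta> n \<noteq> 0 \<and> g n = m}"
    and card: "\<And>m. card {n. \<beta> n \<noteq> 0 \<and> g n = m} \<le> K"
  shows "\<beta> \<in> S"
proof -
  define r where "r n = card {n'. \<beta> n' \<noteq> 0 \<and> g n' = g n \<and> n' < n}" for n
  have r_less: "r n < K" if "\<beta> n \<noteq> 0" for n
  proof -
    have "r n < card {n'. \<beta> n' \<noteq> 0 \<and> g n' = g n}"
      unfolding r_def using that by (intro psubset_card_mono fin) auto
    then show ?thesis using card[of "g n"] by simp
  qed
  have r_mono: "r n < r n'" if "\<beta> n \<noteq> 0" "g n = g n'" "n < n'" for n n'
    unfolding r_def using that
    by (intro psubset_card_mono finite_subset[OF _ fin[of "g n'"]]) auto
  have r_inj: "n = n'" if "\<beta> n \<noteq> 0" "\<beta> n' \<noteq> 0" "g n = g n'" "r n = r n'" for n n'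
    using r_mono[of n n'] r_mono[of n' n] that by (metis less_irrefl linorder_neqE_nat)
  define \<gamma> where "\<gamma> k n = (if r n = k then \<beta> n else 0)" for k n
  have "\<gamma> k \<in> S" for k
  proof -
    \<comment> \<open>\<open>f\<close> inverts \<open>g\<close> on the piece of rank
      \<open>k\<close>, so pushing \<open>\<alpha>\<close> forward along it puts
      \<open>\<alpha> (g n)\<close> at each \<open>n\<close> of that piece.\<close>
    define f where "f m = (if \<exists>n. \<beta> n \<noteq> 0 \<and> g n = m \<and> r n = k
      then Some (SOME n. \<beta> n \<noteq> 0 \<and> g n = m \<and> r n = k) else None)" for m
    have f: "f m = Some n \<longleftrightarrow> \<beta> n \<noteq> 0 \<and> g n = m \<and> r n = k" for m n
    proof
      assume fm: "f m = Some n"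
      then have ex: "\<exists>n. \<beta> n \<noteq> 0 \<and> g n = m \<and> r n = k"
        unfolding f_def by (metis option.distinct(1))
      then have "n = (SOME n. \<beta> n \<noteq> 0 \<and> g n = m \<and> r n = k)"
        using fm by (simp add: f_def)
      then show "\<beta> n \<noteq> 0 \<and> g n = m \<and> r n = k"
        using someI_ex[OF ex] by simp
    next
      assume n: "\<beta> n \<noteq> 0 \<and> g n = m \<and> r n = k"
      have "(SOME n. \<beta> n \<noteq> 0 \<and> g n = m \<and> r n = k) = n"
        using n r_inj by (intro some_equality) auto
      with n show "f m = Some n"
        unfolding f_def by auto
    qed
    have "partial_inj f"
      unfolding partial_inj_def by (rule inj_onI) (metis domD f)
    then have "push_forward f \<alpha> \<in> S"
      using S \<alpha> by (simp add: symmetric_ideal_def)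
    moreover have "cmod (\<gamma> k n) \<le> \<bar>C\<bar> * cmod (push_forward f \<alpha> n)" for n
    proof (cases "\<beta> n \<noteq> 0 \<and> r n = k")
      case True
      then have "(THE m. f m = Some n) = g n" "n \<in> ran f"
        by (auto simp: f ran_def)
      moreover have "cmod (\<beta> n) \<le> \<bar>C\<bar> * cmod (\<alpha> (g n))"
        using le[of n] by (smt (verit) mult_right_mono norm_ge_zero)
      ultimately show ?thesis
        using True by (simp add: push_forward_def \<gamma>_def)
    qed (auto simp: \<gamma>_def)
    ultimately show ?thesis
      by (rule symmetric_ideal_le)
  qed
  then have "(\<lambda>n. \<Sum>k<K. \<gamma> k n) \<in> S"
    by (rule symmetric_ideal_sum)
  \<comment> \<open>Ranks on the support lie below \<open>K\<close>, so each \<open>n\<close> there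
    is counted in exactly one piece.\<close>
  moreover have "(\<Sum>k<K. \<gamma> k n) = \<beta> n" for n
    using r_less[of n] by (cases "\<beta> n = 0") (auto simp: \<gamma>_def)
  ultimately show ?thesis by simp
qed

text \<open>The ideal \<open>S\<close> provides the ring axioms for \<open>linf_ring\<close>, of
  which \<open>linf\<close> is the unit ideal. A push-forward only moves values and inserts zeros,
  so boundedness is kept.\<close>

lemma symmetric_ideal_linf: "symmetric_ideal linf"
proof -
  have "ideal linf linf_ring"
    using oneideal by (simp add: linf_ring_def)
  moreover have "push_forward f \<alpha> \<in> linf" if \<alpha>: "\<alpha> \<in> linf" for f \<alpha>
  proof -
    obtain C where "\<And>n. cmod (\<alpha> n) \<le> C"
      using \<alpha> by (auto simp: linf_def bounded_iff)
    then have "cmod (push_forward f \<alpha> n) \<le> max 0 C" for n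
      by (simp add: push_forward_def le_max_iff_disj)
    then show ?thesis
      by (auto simp: linf_def bounded_iff)
  qed
  ultimately show ?thesis
    by (simp add: symmetric_ideal_def)
qed

end

section \<open>Matrices with weighted columns and rows\<close>

text \<open>Real values make pointwise comparison possible. For a symmetric ideal the sum of two
  weights is a weight dominating both, so these sequences form a directed set.\<close>

definition weights :: "(nat \<Rightarrow> complex) set \<Rightarrow> (nat \<Rightarrow> real) set" where
  "weights S = {w. (\<forall>n. 0 \<le> w n) \<and> (\<lambda>n. complex_of_real (w n)) \<in> S}"

lemma weights_nonneg: "w \<in> weights S \<Longrightarrow> 0 \<le> w n"
  by (simp add: weights_def)

lemma weights_zero: "symmetric_ideal S \<Longrightarrow> (\<lambda>n. 0) \<in> weights S"
  using symmetric_ideal_zero by (simp add: weights_def)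

lemma weights_add: "symmetric_ideal S \<Longrightarrow> v \<in> weights S \<Longrightarrow> w \<in> weights S \<Longrightarrow> (\<lambda>n. v n + w n) \<in> weights S"
  using symmetric_ideal_add by (auto simp: weights_def)

lemma weights_mult:
  assumes "symmetric_ideal S" "w \<in> weights S" "0 \<le> c"
  shows "(\<lambda>n. c * w n) \<in> weights S"
  using symmetric_ideal_le[OF assms(1), of "\<lambda>n. complex_of_real (w n)" "\<lambda>n. complex_of_real (c * w n)" c] assms
  by (auto simp: weights_def norm_mult)

lemma weights_bounded:
  assumes "symmetric_ideal S" "w \<in> weights S"
  obtains C where "0 \<le> C" "\<And>n. w n \<le> C"
proof -
  obtain C where C: "\<And>n. \<bar>w n\<bar> \<le> C"
    using symmetric_ideal_bounded[OF assms(1), of "\<lambda>n. complex_of_real (w n)"] assms(2)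
    by (auto simp: weights_def bounded_iff)
  show thesis
    by (rule that[of C]) (use order_trans[OF abs_ge_zero C] C in \<open>auto simp: abs_le_iff\<close>)
qed

lemma const_weights_linf: "0 \<le> C \<Longrightarrow> (\<lambda>n. C) \<in> weights linf"
  by (simp add: weights_def linf_def)

section \<open>Supports with uniformly bounded rows and columns\<close>

lemma row_col_boundedE:
  assumes "row_col_bounded A"
  obtains K where "\<And>i. finite {j. A i j \<noteq> 0}" "\<And>i. card {j. A i j \<noteq> 0} \<le> K"
    "\<And>j. finite {i. A i j \<noteq> 0}" "\<And>j. card {i. A i j \<noteq> 0} \<le> K"
  using assms unfolding row_col_bounded_def by blast

lemma row_col_bounded_row_finite: "row_col_bounded A \<Longrightarrow> finite {j. A i j \<noteq> 0}"
  by (auto simp: row_col_bounded_def)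

lemma row_col_bounded_transpose: "row_col_bounded (\<lambda>i j. A j i) \<longleftrightarrow> row_col_bounded A"
  unfolding row_col_bounded_def by blast

lemma row_col_bounded_subset:
  assumes "row_col_bounded A" and sub: "\<And>i j. A i j = 0 \<Longrightarrow> B i j = 0"
  shows "row_col_bounded B"
proof -
  obtain K where K: "\<And>i. finite {j. A i j \<noteq> 0}" "\<And>i. card {j. A i j \<noteq> 0} \<le> K"
    "\<And>j. finite {i. A i j \<noteq> 0}" "\<And>j. card {i. A i j \<noteq> 0} \<le> K"
    using row_col_boundedE[OF assms(1)] by metis
  have row: "{j. B i j \<noteq> 0} \<subseteq> {j. A i j \<noteq> 0}" for i
    using sub by blast
  have col: "{i. B i j \<noteq> 0} \<subseteq> {i. A i j \<noteq> 0}" for j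
    using sub by blast
  show ?thesis
    unfolding row_col_bounded_def
    using finite_subset[OF row K(1)] finite_subset[OF col K(3)]
      order_trans[OF card_mono[OF K(1) row] K(2)] order_trans[OF card_mono[OF K(3) col] K(4)]
    by blast
qed

text \<open>Counts two-step paths from \<open>i\<close> through \<open>j\<close> to
  \<open>k\<close>: at most \<open>K * L\<close> leave each starting point, and at most as many
  reach each end point. Only supports are compared, so cancellation in a product does no
  harm.\<close>

lemma row_col_bounded_UN:
  assumes A: "row_col_bounded A" and B: "row_col_bounded B"
    and C: "\<And>i k. C i k \<noteq> 0 \<Longrightarrow> \<exists>j. A i j \<noteq> 0 \<and> B j k \<noteq> 0"
  shows "row_col_bounded C"
proof -
  obtain K where K: "\<And>i. finite {j. A i j \<noteq> 0}" "\<And>i. card {j. A i j \<noteq> 0} \<le> K"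
    "\<And>j. finite {i. A i j \<noteq> 0}" "\<And>j. card {i. A i j \<noteq> 0} \<le> K"
    using row_col_boundedE[OF A] by metis
  obtain L where L: "\<And>i. finite {j. B i j \<noteq> 0}" "\<And>i. card {j. B i j \<noteq> 0} \<le> L"
    "\<And>j. finite {i. B i j \<noteq> 0}" "\<And>j. card {i. B i j \<noteq> 0} \<le> L"
    using row_col_boundedE[OF B] by metis
  \<comment> \<open>The bounds \<open>k\<close> and \<open>l\<close> are kept apart from
    \<open>K\<close> and \<open>L\<close> because rows and columns use these in opposite
    order.\<close>
  have UN: "finite Y \<and> card Y \<le> K * L"
    if "finite X" "card X \<le> k" "\<And>x. finite (Z x)" "\<And>x. card (Z x) \<le> l" "Y \<subseteq> (\<Union>x\<in>X. Z x)" "k * l \<le> K * L"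
    for X Y :: "nat set" and Z k l
  proof -
    have "card (\<Union>x\<in>X. Z x) \<le> (\<Sum>x\<in>X. card (Z x))"
      using that by (intro card_UN_le)
    also have "\<dots> \<le> card X * l"
      using that sum_bounded_above[of X "\<lambda>x. card (Z x)" l] by simp
    also have "\<dots> \<le> K * L"
      using that mult_le_mono1[of "card X" k l] by linarith
    finally have "card (\<Union>x\<in>X. Z x) \<le> K * L" .
    moreover have "finite (\<Union>x\<in>X. Z x)" using that by blast
    ultimately show ?thesis
      using that by (meson card_mono finite_subset order_trans)
  qed
  have "finite {k. C i k \<noteq> 0} \<and> card {k. C i k \<noteq> 0} \<le> K * L" for i
    by (rule UN[OF K(1,2)[of i] L(1,2)]) (use C in auto)
  moreover have "finite {i. C i k \<noteq> 0} \<and> card {i. C i k \<noteq> 0} \<le> K * L" for k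
    by (rule UN[where Z = "\<lambda>j. {i. A i j \<noteq> 0}", OF L(3,4)[of k] K(3,4)]) (use C in \<open>auto simp: mult.commute\<close>)
  ultimately show ?thesis
    unfolding row_col_bounded_def by blast
qed

lemma row_col_bounded_add:
  fixes A B :: "nat \<Rightarrow> nat \<Rightarrow> 'a::monoid_add"
  assumes A: "row_col_bounded A" and B: "row_col_bounded B"
  shows "row_col_bounded (\<lambda>i j. A i j + B i j)"
proof -
  obtain K where K: "\<And>i. finite {j. A i j \<noteq> 0}" "\<And>i. card {j. A i j \<noteq> 0} \<le> K"
    "\<And>j. finite {i. A i j \<noteq> 0}" "\<And>j. card {i. A i j \<noteq> 0} \<le> K"
    using row_col_boundedE[OF A] by metis
  obtain L where L: "\<And>i. finite {j. B i j \<noteq> 0}" "\<And>i. card {j. B i j \<noteq> 0} \<le> L"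
    "\<And>j. finite {i. B i j \<noteq> 0}" "\<And>j. card {i. B i j \<noteq> 0} \<le> L"
    using row_col_boundedE[OF B] by metis
  have Un: "finite Z \<and> card Z \<le> K + L"
    if "finite X" "card X \<le> K" "finite Y" "card Y \<le> L" "Z \<subseteq> X \<union> Y" for X Y Z :: "nat set"
    using that card_Un_le[of X Y] card_mono[of "X \<union> Y" Z]
    by (meson add_mono finite_UnI finite_subset order_trans)
  have "finite {j. A i j + B i j \<noteq> 0} \<and> card {j. A i j + B i j \<noteq> 0} \<le> K + L" for i
    by (rule Un[OF K(1,2)[of i] L(1,2)[of i]]) auto
  moreover have "finite {i. A i j + B i j \<noteq> 0} \<and> card {i. A i j + B i j \<noteq> 0} \<le> K + L" for j
    by (rule Un[OF K(3,4)[of j] L(3,4)[of j]]) auto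
  ultimately show ?thesis
    unfolding row_col_bounded_def by blast
qed

lemma row_col_bounded_diagonal: "row_col_bounded (\<lambda>i j. if i = j then w i else 0)"
proof -
  have row: "{j. (if i = j then w i else 0) \<noteq> 0} \<subseteq> {i}"
    and col: "{j. (if j = i then w j else 0) \<noteq> 0} \<subseteq> {i}" for i
    by auto
  have "card {j. (if i = j then w i else 0) \<noteq> 0} \<le> 1" for i
    by (rule order_trans[OF card_mono[OF _ row]]) simp_all
  moreover have "card {j. (if j = i then w j else 0) \<noteq> 0} \<le> 1" for i
    by (rule order_trans[OF card_mono[OF _ col]]) simp_all
  moreover note finite_subset[OF row] finite_subset[OF col]
  ultimately show ?thesis
    unfolding row_col_bounded_def by blast
qed

text \<open>Membership in \<open>seq_space S\<close> can be tested with any enumeration of the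
  pairs. Enumerating once by \<open>prod_decode\<close> and once with the coordinates swapped
  produces the same sequence of norms for both matrices.\<close>

lemma matrix_ideal_transpose:
  assumes S: "symmetric_ideal S"
  shows "(\<lambda>i j. A j i) \<in> matrix_ideal S \<longleftrightarrow> A \<in> matrix_ideal S"
proof -
  have swap: "bij (prod.swap \<circ> prod_decode)"
    by (intro bij_comp bij_prod_decode) simp
  have "range (\<lambda>(i, j). A j i) = range (\<lambda>(i, j). A i j)"
    by force
  then have "(\<lambda>(i, j). A j i) \<in> seq_space S \<longleftrightarrow> (\<lambda>(i, j). A i j) \<in> seq_space S"
    unfolding seq_space_iff[OF S bij_prod_decode, of "\<lambda>(i, j). A j i"] seq_space_iff[OF S swap, of "\<lambda>(i, j). A i j"]
    by (simp add: case_prod_beta)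
  then show ?thesis
    by (simp only: matrix_ideal_def mem_Collect_eq row_col_bounded_transpose[of A])
qed

text \<open>Forwards, the column maxima are attained at distinct positions, hence form a reindexed
  part of the sequence of entry norms. Backwards, sending a position to its column is at most
  \<open>K\<close>-to-one on the support, so \<open>symmetric_ideal_dominated\<close> spreads the
  weight over all entries.\<close>

lemma matrix_ideal_iff_columns:
  fixes A :: "nat \<Rightarrow> nat \<Rightarrow> 'a::real_normed_vector"
  assumes S: "symmetric_ideal S"
  shows "A \<in> matrix_ideal S \<longleftrightarrow> row_col_bounded A \<and> (\<exists>w\<in>weights S. \<forall>i j. norm (A i j) \<le> w j)"
proof (intro iffI conjI)
  assume "A \<in> matrix_ideal S"
  then have A: "row_col_bounded A"
    and A_in: "(\<lambda>n. complex_of_real (norm (case prod_decode n of (i, j) \<Rightarrow> A i j))) \<in> S"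
    by (auto simp: matrix_ideal_def seq_space_iff[OF S bij_prod_decode])
  show "row_col_bounded A" by fact
  \<comment> \<open>A column has finitely many nonzero entries, so the largest norm is attained; in
    a zero column every \<open>m\<close> serves.\<close>
  have "\<exists>m. \<forall>i. norm (A i j) \<le> norm (A m j)" for j
  proof -
    have fin: "finite ((\<lambda>i. norm (A i j)) ` {i. A i j \<noteq> 0})"
      using A by (auto simp: row_col_bounded_def)
    show ?thesis
    proof (cases "{i. A i j \<noteq> 0} = {}")
      case False
      then obtain m where m: "norm (A m j) = Max ((\<lambda>i. norm (A i j)) ` {i. A i j \<noteq> 0})"
        using Max_in[OF fin] by (metis (mono_tags, lifting) image_iff image_is_empty)
      have "norm (A i j) \<le> norm (A m j)" for i
      proof (cases "A i j = 0")
        case False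
        then show ?thesis unfolding m by (intro Max_ge[OF fin]) auto
      qed simp
      then show ?thesis by blast
    qed auto
  qed
  then obtain m where m: "\<And>i j. norm (A i j) \<le> norm (A (m j) j)"
    by metis
  \<comment> \<open>The second coordinate of a position recovers the column, so the map from columns
    to positions has fibres of at most one element.\<close>
  have fibre: "{n. complex_of_real (norm (A (m n) n)) \<noteq> 0 \<and> prod_encode (m n, n) = k} \<subseteq> {snd (prod_decode k)}" for k
    by auto
  have "(\<lambda>j. complex_of_real (norm (A (m j) j))) \<in> S"
    by (rule symmetric_ideal_dominated[OF S A_in, of _ 1 "\<lambda>j. prod_encode (m j, j)" 1])
      (use finite_subset[OF fibre] card_mono[OF _ fibre] in auto)
  then have "(\<lambda>j. norm (A (m j) j)) \<in> weights S"
    by (simp add: weights_def)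
  then show "\<exists>w\<in>weights S. \<forall>i j. norm (A i j) \<le> w j"
    using m by (intro bexI[of _ "\<lambda>j. norm (A (m j) j)"]) auto
next
  assume "row_col_bounded A \<and> (\<exists>w\<in>weights S. \<forall>i j. norm (A i j) \<le> w j)"
  then obtain w where A: "row_col_bounded A" and w: "w \<in> weights S" and le: "\<And>i j. norm (A i j) \<le> w j"
    by blast
  obtain K where K: "\<And>j. finite {i. A i j \<noteq> 0}" "\<And>j. card {i. A i j \<noteq> 0} \<le> K"
    using row_col_boundedE[OF A] by metis
  obtain C where C: "\<And>n. w n \<le> C"
    using weights_bounded[OF S w] by metis
  let ?\<beta> = "\<lambda>n. complex_of_real (norm (case prod_decode n of (i, j) \<Rightarrow> A i j))"
  have fibre: "{n. ?\<beta> n \<noteq> 0 \<and> snd (prod_decode n) = j} \<subseteq> (\<lambda>i. prod_encode (i, j)) ` {i. A i j \<noteq> 0}" for j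
  proof
    fix n assume "n \<in> {n. ?\<beta> n \<noteq> 0 \<and> snd (prod_decode n) = j}"
    then show "n \<in> (\<lambda>i. prod_encode (i, j)) ` {i. A i j \<noteq> 0}"
      by (intro image_eqI[of _ _ "fst (prod_decode n)"]) (auto simp: case_prod_beta)
  qed
  have "?\<beta> \<in> S"
  proof (rule symmetric_ideal_dominated[OF S, of "\<lambda>n. complex_of_real (w n)"])
    show "(\<lambda>n. complex_of_real (w n)) \<in> S"
      using w by (simp add: weights_def)
    show "cmod (?\<beta> n) \<le> 1 * cmod (complex_of_real (w (snd (prod_decode n))))" for n
      using le[of "fst (prod_decode n)" "snd (prod_decode n)"] weights_nonneg[OF w]
      by (simp add: case_prod_beta)
    show "finite {n. ?\<beta> n \<noteq> 0 \<and> snd (prod_decode n) = j}" for j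
      using finite_subset[OF fibre] K by blast
    show "card {n. ?\<beta> n \<noteq> 0 \<and> snd (prod_decode n) = j} \<le> K" for j
      using card_mono[OF _ fibre[of j]] card_image_le[OF K(1)[of j], of "\<lambda>i. prod_encode (i, j)"] K
      by (meson finite_imageI order_trans)
  qed
  moreover have "bounded (range (\<lambda>(i, j). A i j))"
    unfolding bounded_iff using order_trans[OF le C] by auto
  ultimately show "A \<in> matrix_ideal S"
    using A by (simp add: matrix_ideal_def seq_space_iff[OF S bij_prod_decode])
qed

lemma matrix_ideal_iff_rows:
  fixes A :: "nat \<Rightarrow> nat \<Rightarrow> 'a::real_normed_vector"
  assumes S: "symmetric_ideal S"
  shows "A \<in> matrix_ideal S \<longleftrightarrow> row_col_bounded A \<and> (\<exists>w\<in>weights S. \<forall>i j. norm (A i j) \<le> w i)"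
  using matrix_ideal_iff_columns[OF S, of "\<lambda>i j. A j i"] matrix_ideal_transpose[OF S, of A]
  unfolding row_col_bounded_transpose[of A] by blast

section \<open>The matrix ring\<close>

text \<open>The index set of \<open>mat_mult\<close> varies with the left factor, and a sum over an
  infinite set is \<open>0\<close> by convention. Passing to a common finite index set lets products
  with different supports be compared.\<close>

lemma mat_mult_eq_sum:
  assumes "finite T" "{j. A i j \<noteq> 0} \<subseteq> T"
  shows "mat_mult A B i k = (\<Sum>j\<in>T. A i j * B j k)"
  unfolding mat_mult_def using assms by (intro sum.mono_neutral_left) auto

lemma mat_mult_add_left:
  fixes A B C :: "nat \<Rightarrow> nat \<Rightarrow> 'a::semiring_0"
  assumes "row_col_bounded A" "row_col_bounded B"
  shows "mat_mult (\<lambda>i j. A i j + B i j) C = (\<lambda>i j. mat_mult A C i j + mat_mult B C i j)"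
proof (intro ext)
  fix i k
  let ?T = "{j. A i j \<noteq> 0} \<union> {j. B i j \<noteq> 0}"
  have T: "finite ?T"
    using assms by (simp add: row_col_bounded_row_finite)
  show "mat_mult (\<lambda>i j. A i j + B i j) C i k = mat_mult A C i k + mat_mult B C i k"
    by (subst (1 2 3) mat_mult_eq_sum[OF T]) (auto simp: distrib_right sum.distrib)
qed

lemma mat_mult_add_right:
  "mat_mult A (\<lambda>i j. B i j + C i j) = (\<lambda>i j. mat_mult A B i j + mat_mult A C i j)"
  by (intro ext) (simp add: mat_mult_def distrib_left sum.distrib)

lemma mat_mult_nonzeroE:
  assumes "mat_mult A B i k \<noteq> 0"
  obtains j where "A i j \<noteq> 0" "B j k \<noteq> 0"
proof -
  obtain j where "A i j \<noteq> 0" "A i j * B j k \<noteq> 0"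
    using assms unfolding mat_mult_def by (auto elim: sum.not_neutral_contains_not_neutral)
  then show thesis
    by (metis mult_zero_right that)
qed

lemma mat_mult_assoc:
  fixes A B C :: "nat \<Rightarrow> nat \<Rightarrow> 'a::semiring_0"
  assumes A: "row_col_bounded A" and B: "row_col_bounded B"
  shows "mat_mult (mat_mult A B) C = mat_mult A (mat_mult B C)"
proof (intro ext)
  fix i l
  let ?X = "{j. A i j \<noteq> 0}"
  \<comment> \<open>The columns reachable from row \<open>i\<close> through \<open>A\<close> and
    then \<open>B\<close>: one finite set carrying the inner sums for every \<open>j\<close>, so
    that the summations can be exchanged.\<close>
  let ?T = "\<Union>j\<in>?X. {k. B j k \<noteq> 0}"
  have T: "finite ?T"
    using assms by (auto simp: row_col_bounded_row_finite)
  have "{k. mat_mult A B i k \<noteq> 0} \<subseteq> ?T"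
    by (auto elim: mat_mult_nonzeroE)
  then have "mat_mult (mat_mult A B) C i l = (\<Sum>k\<in>?T. \<Sum>j\<in>?X. A i j * B j k * C k l)"
    by (simp add: mat_mult_eq_sum[OF T] sum_distrib_right mat_mult_def[of A B])
  also have "\<dots> = (\<Sum>j\<in>?X. \<Sum>k\<in>?T. A i j * (B j k * C k l))"
    by (subst sum.swap) (simp add: mult.assoc)
  also have "\<dots> = (\<Sum>j\<in>?X. A i j * mat_mult B C j l)"
  proof (intro sum.cong refl)
    fix j assume "j \<in> ?X"
    then have "{k. B j k \<noteq> 0} \<subseteq> ?T" by blast
    then show "(\<Sum>k\<in>?T. A i j * (B j k * C k l)) = A i j * mat_mult B C j l"
      by (simp add: mat_mult_eq_sum[OF T] sum_distrib_left)
  qed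
  finally show "mat_mult (mat_mult A B) C i l = mat_mult A (mat_mult B C) i l"
    by (simp add: mat_mult_def[of A "mat_mult B C"])
qed

lemma row_col_bounded_mat_mult:
  assumes "row_col_bounded A" "row_col_bounded B"
  shows "row_col_bounded (mat_mult A B)"
  by (rule row_col_bounded_UN[OF assms]) (auto elim: mat_mult_nonzeroE)

section \<open>Diagonal and identity matrices\<close>

definition diagonal_matrix :: "(nat \<Rightarrow> real) \<Rightarrow> nat \<Rightarrow> nat \<Rightarrow> 'a::complex_banach_algebra_unital" where
  "diagonal_matrix w i j = (if i = j then w i *\<^sub>R 1 else 0)"

lemma mat_mult_diagonal_left:
  fixes A :: "nat \<Rightarrow> nat \<Rightarrow> 'a::complex_banach_algebra_unital"
  shows "mat_mult (diagonal_matrix w) A i k = w i *\<^sub>R A i k"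
proof -
  have "mat_mult (diagonal_matrix w) A i k = (\<Sum>j\<in>{i}. diagonal_matrix w i j * A j k)"
    by (rule mat_mult_eq_sum) (auto simp: diagonal_matrix_def)
  then show ?thesis by (simp add: diagonal_matrix_def)
qed

lemma mat_mult_diagonal_right:
  fixes A :: "nat \<Rightarrow> nat \<Rightarrow> 'a::complex_banach_algebra_unital"
  assumes "row_col_bounded A"
  shows "mat_mult A (diagonal_matrix w) i k = w k *\<^sub>R A i k"
proof -
  have T: "finite (insert k {j. A i j \<noteq> 0})"
    using assms by (simp add: row_col_bounded_row_finite)
  have "mat_mult A (diagonal_matrix w) i k = (\<Sum>j\<in>insert k {j. A i j \<noteq> 0}. A i j * diagonal_matrix w j k)"
    by (rule mat_mult_eq_sum[OF T]) auto
  also have "\<dots> = (\<Sum>j\<in>{k}. A i j * diagonal_matrix w j k)"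
    by (rule sum.mono_neutral_right[OF T]) (auto simp: diagonal_matrix_def)
  finally show ?thesis by (simp add: diagonal_matrix_def)
qed

definition identity_matrix :: "nat \<Rightarrow> nat \<Rightarrow> 'a::complex_banach_algebra_unital" where
  "identity_matrix i j = (if i = j then 1 else 0)"

lemma identity_matrix_eq_diagonal: "identity_matrix = diagonal_matrix (\<lambda>n. 1)"
  by (simp add: fun_eq_iff identity_matrix_def diagonal_matrix_def)

lemma mat_mult_identity_left: "mat_mult identity_matrix A = A"
  by (simp add: fun_eq_iff identity_matrix_eq_diagonal mat_mult_diagonal_left)

lemma mat_mult_identity_right: "row_col_bounded A \<Longrightarrow> mat_mult A identity_matrix = A"
  by (simp add: fun_eq_iff identity_matrix_eq_diagonal mat_mult_diagonal_right)

section \<open>Closure of matrix ideals under sums, negatives and products\<close>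

context
  fixes S :: "(nat \<Rightarrow> complex) set"
  assumes S: "symmetric_ideal S"
begin

lemma matrix_ideal_row_col_bounded: "A \<in> matrix_ideal S \<Longrightarrow> row_col_bounded A"
  by (simp add: matrix_ideal_def)

lemma matrix_ideal_columnsI:
  "\<lbrakk>row_col_bounded A; w \<in> weights S; \<And>i j. norm (A i j) \<le> w j\<rbrakk> \<Longrightarrow> A \<in> matrix_ideal S"
  unfolding matrix_ideal_iff_columns[OF S] by blast

lemma matrix_ideal_rowsI:
  "\<lbrakk>row_col_bounded A; w \<in> weights S; \<And>i j. norm (A i j) \<le> w i\<rbrakk> \<Longrightarrow> A \<in> matrix_ideal S"
  unfolding matrix_ideal_iff_rows[OF S] by blast

lemma matrix_ideal_zero: "(\<lambda>i j. 0) \<in> matrix_ideal S"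
  unfolding matrix_ideal_iff_columns[OF S] using weights_zero[OF S]
  by (auto simp: row_col_bounded_def)

lemma matrix_ideal_add:
  assumes "A \<in> matrix_ideal S" "B \<in> matrix_ideal S"
  shows "(\<lambda>i j. A i j + B i j) \<in> matrix_ideal S"
proof -
  obtain v where v: "v \<in> weights S" "\<And>i j. norm (A i j) \<le> v j"
    using assms(1) unfolding matrix_ideal_iff_columns[OF S] by blast
  obtain w where w: "w \<in> weights S" "\<And>i j. norm (B i j) \<le> w j"
    using assms(2) unfolding matrix_ideal_iff_columns[OF S] by blast
  show ?thesis
    by (rule matrix_ideal_columnsI[OF row_col_bounded_add weights_add[OF S v(1) w(1)]])
      (simp_all add: assms matrix_ideal_row_col_bounded norm_triangle_mono v w)
qed

lemma matrix_ideal_uminus: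
  assumes "A \<in> matrix_ideal S"
  shows "(\<lambda>i j. - A i j) \<in> matrix_ideal S"
  using assms unfolding matrix_ideal_iff_columns[OF S]
  by (auto intro: row_col_bounded_subset)

text \<open>Left multiplication preserves column weights up to a constant: an entry in column
  \<open>k\<close> of the product has at most \<open>K\<close> terms, each of norm at most
  \<open>C * w k\<close>.\<close>

lemma matrix_ideal_mult_left:
  fixes A B :: "nat \<Rightarrow> nat \<Rightarrow> 'a::complex_banach_algebra_unital"
  assumes A: "A \<in> matrix_ideal linf" and B: "B \<in> matrix_ideal S"
  shows "mat_mult A B \<in> matrix_ideal S"
proof -
  have rc: "row_col_bounded A" "row_col_bounded B"
    using A B by (simp_all add: matrix_ideal_def)
  obtain v where v: "v \<in> weights linf" "\<And>i j. norm (A i j) \<le> v j"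
    using A unfolding matrix_ideal_iff_columns[OF symmetric_ideal_linf[OF S]] by blast
  obtain C where C: "0 \<le> C" "\<And>n. v n \<le> C"
    using weights_bounded[OF symmetric_ideal_linf[OF S] v(1)] by metis
  obtain w where w: "w \<in> weights S" "\<And>i j. norm (B i j) \<le> w j"
    using B unfolding matrix_ideal_iff_columns[OF S] by blast
  obtain K where K: "\<And>i. card {j. A i j \<noteq> 0} \<le> K"
    using row_col_boundedE[OF rc(1)] by metis
  have "norm (mat_mult A B i k) \<le> (real K * C) * w k" for i k
  proof -
    have "norm (A i j * B j k) \<le> C * w k" for j
      using norm_mult_ineq[of "A i j" "B j k"] mult_mono[OF order_trans[OF v(2) C(2)] w(2) C(1) norm_ge_zero]
      by (rule order_trans)
    then have "norm (mat_mult A B i k) \<le> real (card {j. A i j \<noteq> 0}) * (C * w k)"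
      unfolding mat_mult_def by (intro order_trans[OF norm_sum] sum_bounded_above)
    also have "\<dots> \<le> real K * (C * w k)"
      using K C weights_nonneg[OF w(1)] by (intro mult_right_mono) simp_all
    finally show ?thesis by (simp add: mult.assoc)
  qed
  moreover have "(\<lambda>n. (real K * C) * w n) \<in> weights S"
    using C by (intro weights_mult S w) simp
  ultimately show ?thesis
    by (rule matrix_ideal_columnsI[OF row_col_bounded_mat_mult[OF rc], rotated])
qed

text \<open>Multiplying from the right mixes columns but keeps rows, so row weights of
  \<open>A\<close> are used here.\<close>

lemma matrix_ideal_mult_right:
  fixes A B :: "nat \<Rightarrow> nat \<Rightarrow> 'a::complex_banach_algebra_unital"
  assumes A: "A \<in> matrix_ideal S" and B: "B \<in> matrix_ideal linf"
  shows "mat_mult A B \<in> matrix_ideal S"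
proof -
  have rc: "row_col_bounded A" "row_col_bounded B"
    using A B by (simp_all add: matrix_ideal_def)
  obtain v where v: "v \<in> weights linf" "\<And>i j. norm (B i j) \<le> v j"
    using B unfolding matrix_ideal_iff_columns[OF symmetric_ideal_linf[OF S]] by blast
  obtain C where C: "0 \<le> C" "\<And>n. v n \<le> C"
    using weights_bounded[OF symmetric_ideal_linf[OF S] v(1)] by metis
  obtain w where w: "w \<in> weights S" "\<And>i j. norm (A i j) \<le> w i"
    using A unfolding matrix_ideal_iff_rows[OF S] by blast
  obtain K where K: "\<And>i. card {j. A i j \<noteq> 0} \<le> K"
    using row_col_boundedE[OF rc(1)] by metis
  have "norm (mat_mult A B i k) \<le> (real K * C) * w i" for i k
  proof -
    have "norm (A i j * B j k) \<le> w i * C" for j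
      using norm_mult_ineq[of "A i j" "B j k"]
        mult_mono[OF w(2) order_trans[OF v(2) C(2)] weights_nonneg[OF w(1)] norm_ge_zero]
      by (rule order_trans)
    then have "norm (mat_mult A B i k) \<le> real (card {j. A i j \<noteq> 0}) * (w i * C)"
      unfolding mat_mult_def by (intro order_trans[OF norm_sum] sum_bounded_above)
    also have "\<dots> \<le> real K * (w i * C)"
      using K C weights_nonneg[OF w(1)] by (intro mult_right_mono) simp_all
    finally show ?thesis by (simp add: mult_ac)
  qed
  moreover have "(\<lambda>n. (real K * C) * w n) \<in> weights S"
    using C by (intro weights_mult S w) simp
  ultimately show ?thesis
    by (rule matrix_ideal_rowsI[OF row_col_bounded_mat_mult[OF rc], rotated])
qed

lemma diagonal_matrix_in_matrix_ideal:
  assumes w: "w \<in> weights S"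
  shows "diagonal_matrix w \<in> (matrix_ideal S :: (nat \<Rightarrow> nat \<Rightarrow> 'a::complex_banach_algebra_unital) set)"
proof -
  have "row_col_bounded (diagonal_matrix w :: nat \<Rightarrow> nat \<Rightarrow> 'a)"
    unfolding diagonal_matrix_def by (rule row_col_bounded_diagonal)
  \<comment> \<open>The class does not fix the value of \<open>norm 1\<close>, hence the constant in
    front of the weight.\<close>
  moreover have "norm (diagonal_matrix w i j :: 'a) \<le> norm (1 :: 'a) * w j" for i j
    using weights_nonneg[OF w] by (simp add: diagonal_matrix_def mult.commute)
  ultimately show ?thesis
    by (rule matrix_ideal_columnsI[OF _ weights_mult[OF S w norm_ge_zero]])
qed

end

lemma identity_matrix_in_matrix_ideal:
  assumes "symmetric_ideal linf"
  shows "identity_matrix \<in> matrix_ideal linf"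
  unfolding identity_matrix_eq_diagonal
  using assms by (intro diagonal_matrix_in_matrix_ideal const_weights_linf) simp_all

section \<open>The ring of matrices and its two modules\<close>

lemma Gamma_inf_simps [simp]:
  "carrier Gamma_inf = matrix_ideal linf"
  "A \<otimes>\<^bsub>Gamma_inf\<^esub> B = mat_mult A B"
  "\<one>\<^bsub>Gamma_inf\<^esub> = identity_matrix"
  "\<zero>\<^bsub>Gamma_inf\<^esub> = (\<lambda>i j. 0)"
  "A \<oplus>\<^bsub>Gamma_inf\<^esub> B = (\<lambda>i j. A i j + B i j)"
  by (simp_all add: Gamma_inf_def identity_matrix_def fun_eq_iff)

lemma matrix_ideal_left_simps [simp]:
  "carrier (matrix_ideal_left S) = matrix_ideal S"
  "\<zero>\<^bsub>matrix_ideal_left S\<^esub> = (\<lambda>i j. 0)"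
  "A \<oplus>\<^bsub>matrix_ideal_left S\<^esub> B = (\<lambda>i j. A i j + B i j)"
  "G \<odot>\<^bsub>matrix_ideal_left S\<^esub> A = mat_mult G A"
  by (simp_all add: matrix_ideal_left_def)

lemma matrix_ideal_right_simps [simp]:
  "carrier (matrix_ideal_right S) = matrix_ideal S"
  "\<zero>\<^bsub>matrix_ideal_right S\<^esub> = (\<lambda>i j. 0)"
  "A \<oplus>\<^bsub>matrix_ideal_right S\<^esub> B = (\<lambda>i j. A i j + B i j)"
  "G \<odot>\<^bsub>matrix_ideal_right S\<^esub> A = mat_mult A G"
  by (simp_all add: matrix_ideal_right_def)

text \<open>Stated for any record with pointwise addition, so that one proof serves the ring and
  both modules.\<close>

lemma abelian_group_matrix_ideal:
  fixes G :: "(nat \<Rightarrow> nat \<Rightarrow> 'a::real_normed_vector, 'b) ring_scheme"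
  assumes S: "symmetric_ideal S"
    and carrier: "carrier G = matrix_ideal S" and zero: "\<zero>\<^bsub>G\<^esub> = (\<lambda>i j. 0)"
    and add: "\<And>A B. A \<oplus>\<^bsub>G\<^esub> B = (\<lambda>i j. A i j + B i j)"
  shows "abelian_group G"
proof (rule abelian_groupI)
  fix A assume "A \<in> carrier G"
  then show "\<exists>B\<in>carrier G. B \<oplus>\<^bsub>G\<^esub> A = \<zero>\<^bsub>G\<^esub>"
    using matrix_ideal_uminus[OF S, of A]
    by (intro bexI[of _ "\<lambda>i j. - A i j"]) (simp_all add: carrier zero add)
qed (simp_all add: carrier zero add matrix_ideal_zero[OF S] matrix_ideal_add[OF S] add_ac)

context
  fixes S :: "(nat \<Rightarrow> complex) set"
  assumes S: "symmetric_ideal S"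
begin

lemma ring_Gamma_inf: "ring (Gamma_inf :: (nat \<Rightarrow> nat \<Rightarrow> 'a::complex_banach_algebra_unital) ring)"
proof (rule ringI)
  note linf = symmetric_ideal_linf[OF S]
  show "abelian_group (Gamma_inf :: (nat \<Rightarrow> nat \<Rightarrow> 'a) ring)"
    by (rule abelian_group_matrix_ideal[OF linf]) simp_all
  show "monoid (Gamma_inf :: (nat \<Rightarrow> nat \<Rightarrow> 'a) ring)"
    by (rule monoidI)
      (simp_all add: matrix_ideal_mult_left[OF linf] identity_matrix_in_matrix_ideal[OF linf] mat_mult_assoc
        matrix_ideal_row_col_bounded[OF linf] mat_mult_identity_left mat_mult_identity_right)
qed (simp_all add: mat_mult_add_left mat_mult_add_right matrix_ideal_def)

lemma left_module_matrix_ideal: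
  "left_module (Gamma_inf :: (nat \<Rightarrow> nat \<Rightarrow> 'a::complex_banach_algebra_unital) ring) (matrix_ideal_left S)"
proof (intro left_module.intro left_module_axioms.intro ring_Gamma_inf)
  show "abelian_group (matrix_ideal_left S :: (_, nat \<Rightarrow> nat \<Rightarrow> 'a) module)"
    by (rule abelian_group_matrix_ideal[OF S]) simp_all
qed (simp_all add: matrix_ideal_mult_left[OF S] mat_mult_add_left mat_mult_add_right mat_mult_assoc
    matrix_ideal_row_col_bounded[OF S] matrix_ideal_row_col_bounded[OF symmetric_ideal_linf[OF S]]
    mat_mult_identity_left)

lemma right_module_matrix_ideal:
  "right_module (Gamma_inf :: (nat \<Rightarrow> nat \<Rightarrow> 'a::complex_banach_algebra_unital) ring) (matrix_ideal_right S)"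
proof (intro right_module.intro right_module_axioms.intro ring_Gamma_inf)
  show "abelian_group (matrix_ideal_right S :: (_, nat \<Rightarrow> nat \<Rightarrow> 'a) module)"
    by (rule abelian_group_matrix_ideal[OF S]) simp_all
qed (simp_all add: matrix_ideal_mult_right[OF S] mat_mult_add_left mat_mult_add_right mat_mult_assoc
    matrix_ideal_row_col_bounded[OF S] matrix_ideal_row_col_bounded[OF symmetric_ideal_linf[OF S]]
    mat_mult_identity_right)

section \<open>Dividing by weights\<close>

text \<open>The upper tails of the directed set \<open>weights S\<close>; passing along this filter
  plays the part of the directed union of the principal submodules generated by diagonal
  matrices.\<close>

definition weight_filter :: "(nat \<Rightarrow> real) filter" where
  "weight_filter = (INF v\<in>weights S. principal {w\<in>weights S. \<forall>n. v n \<le> w n})"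

lemma eventually_weight_filter:
  "eventually P weight_filter \<longleftrightarrow> (\<exists>v\<in>weights S. \<forall>w\<in>weights S. (\<forall>n. v n \<le> w n) \<longrightarrow> P w)"
  unfolding weight_filter_def
proof (subst eventually_INF_base)
  show "weights S \<noteq> {}"
    using weights_zero[OF S] by blast
  fix u v assume uv: "u \<in> weights S" "v \<in> weights S"
  show "\<exists>x\<in>weights S. principal {w\<in>weights S. \<forall>n. x n \<le> w n} \<le>
      inf (principal {w\<in>weights S. \<forall>n. u n \<le> w n}) (principal {w\<in>weights S. \<forall>n. v n \<le> w n})"
  \<comment> \<open>The sum lies above both \<open>u\<close> and \<open>v\<close> since weights are
    nonnegative, which makes the tails a filter base.\<close>
  proof (intro bexI[of _ "\<lambda>n. u n + v n"])
    have "u n \<le> w n \<and> v n \<le> w n" if "u n + v n \<le> w n" for w :: "nat \<Rightarrow> real" and n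
      using that weights_nonneg[OF uv(1), of n] weights_nonneg[OF uv(2), of n] by linarith
    then show "principal {w\<in>weights S. \<forall>n. u n + v n \<le> w n} \<le>
      inf (principal {w\<in>weights S. \<forall>n. u n \<le> w n}) (principal {w\<in>weights S. \<forall>n. v n \<le> w n})"
      by auto
  qed (use weights_add[OF S] uv in blast)
qed (auto simp: eventually_principal)

text \<open>Every tail contains the weight that defines it.\<close>

lemma weight_filter_nontrivial: "weight_filter \<noteq> bot"
  unfolding trivial_limit_def eventually_weight_filter by blast

text \<open>The divisor may depend on both indices, which covers division of columns and of rows.
  Every quotient has norm at most \<open>1\<close>, also where the divisor is \<open>0\<close> and
  the quotient is \<open>0\<close> by convention.\<close>

lemma quotient_in_matrix_ideal_linf:
  fixes A B :: "nat \<Rightarrow> nat \<Rightarrow> 'a::real_normed_vector"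
  assumes A: "row_col_bounded A" and v: "\<And>i j. 0 \<le> v i j" "\<And>i j. norm (A i j) \<le> v i j"
  shows "(\<lambda>i j. A i j /\<^sub>R v i j) \<in> matrix_ideal linf"
  unfolding matrix_ideal_iff_columns[OF symmetric_ideal_linf[OF S]]
proof (intro conjI bexI allI)
  show "row_col_bounded (\<lambda>i j. A i j /\<^sub>R v i j)"
    using A by (rule row_col_bounded_subset) simp
  show "norm (A i j /\<^sub>R v i j) \<le> 1" for i j
    using v[of i j] by (cases "v i j = 0") (auto simp: divide_simps)
qed (rule const_weights_linf, simp)

text \<open>Where \<open>w j = 0\<close> the division gives \<open>0\<close>; there the column of \<open>A\<close> vanishes, as \<open>w\<close> dominates it.\<close>

lemma left_coordinates:
  "module_coordinates (Gamma_inf :: (nat \<Rightarrow> nat \<Rightarrow> 'a::complex_banach_algebra_unital) ring)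
     (matrix_ideal_left S) weight_filter diagonal_matrix (\<lambda>w A i j. A i j /\<^sub>R w j)"
proof (intro module_coordinates.intro module_coordinates_axioms.intro left_module_matrix_ideal
    weight_filter_nontrivial)
  fix A :: "nat \<Rightarrow> nat \<Rightarrow> 'a"
  assume "A \<in> carrier (matrix_ideal_left S)"
  then obtain v where A: "row_col_bounded A" and v: "v \<in> weights S" and Av: "\<And>i j. norm (A i j) \<le> v j"
    by (auto simp: matrix_ideal_iff_columns[OF S])
  show "eventually (\<lambda>w. diagonal_matrix w \<in> carrier (matrix_ideal_left S :: (_, nat \<Rightarrow> nat \<Rightarrow> 'a) module) \<and>
      (\<lambda>i j. A i j /\<^sub>R w j) \<in> carrier Gamma_inf \<and>
      (\<lambda>i j. A i j /\<^sub>R w j) \<odot>\<^bsub>matrix_ideal_left S\<^esub> diagonal_matrix w = A) weight_filter"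
    unfolding eventually_weight_filter
  \<comment> \<open>The column weight \<open>v\<close> dominating \<open>A\<close> is the threshold:
    any weight above it dominates \<open>A\<close> too.\<close>
  proof (intro bexI[OF _ v] ballI impI conjI)
    fix w assume w: "w \<in> weights S" and vw: "\<forall>n. v n \<le> w n"
    have Aw: "norm (A i j) \<le> w j" for i j
      using order_trans[OF Av] vw by blast
    show "diagonal_matrix w \<in> carrier (matrix_ideal_left S :: (_, nat \<Rightarrow> nat \<Rightarrow> 'a) module)"
      using diagonal_matrix_in_matrix_ideal[OF S w] by simp
    show q: "(\<lambda>i j. A i j /\<^sub>R w j) \<in> carrier Gamma_inf"
      using quotient_in_matrix_ideal_linf[OF A weights_nonneg[OF w] Aw] by simp
    have "w j *\<^sub>R (A i j /\<^sub>R w j) = A i j" for i j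
      using Aw[of i j] by (cases "w j = 0") auto
    then show "(\<lambda>i j. A i j /\<^sub>R w j) \<odot>\<^bsub>matrix_ideal_left S\<^esub> diagonal_matrix w = A"
      using q by (simp add: fun_eq_iff mat_mult_diagonal_right matrix_ideal_def)
  qed
next
  fix w and a A :: "nat \<Rightarrow> nat \<Rightarrow> 'a"
  \<comment> \<open>The sum runs over the support of \<open>a\<close>, which division of
    \<open>A\<close> leaves alone, so this holds for every \<open>w\<close>, dominating or
    not.\<close>
  show "(\<lambda>i j. (a \<odot>\<^bsub>matrix_ideal_left S\<^esub> A) i j /\<^sub>R w j) = a \<otimes>\<^bsub>Gamma_inf\<^esub> (\<lambda>i j. A i j /\<^sub>R w j)"
    by (simp add: fun_eq_iff mat_mult_def scaleR_sum_right)
qed (simp add: scaleR_add_right)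

text \<open>Over the opposite ring a coefficient acts by multiplication from the right, so
  \<open>A\<close> factors as \<open>diagonal_matrix w\<close> times the quotient, and rows are
  divided by row weights.\<close>

lemma right_coordinates:
  "module_coordinates (opposite_ring (Gamma_inf :: (nat \<Rightarrow> nat \<Rightarrow> 'a::complex_banach_algebra_unital) ring))
     (matrix_ideal_right S) weight_filter diagonal_matrix (\<lambda>w A i j. A i j /\<^sub>R w i)"
proof (intro module_coordinates.intro module_coordinates_axioms.intro left_module_opposite_ring
    right_module_matrix_ideal weight_filter_nontrivial)
  fix A :: "nat \<Rightarrow> nat \<Rightarrow> 'a"
  assume "A \<in> carrier (matrix_ideal_right S)"
  then obtain v where A: "row_col_bounded A" and v: "v \<in> weights S" and Av: "\<And>i j. norm (A i j) \<le> v i"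
    by (auto simp: matrix_ideal_iff_rows[OF S])
  show "eventually (\<lambda>w. diagonal_matrix w \<in> carrier (matrix_ideal_right S :: (_, nat \<Rightarrow> nat \<Rightarrow> 'a) module) \<and>
      (\<lambda>i j. A i j /\<^sub>R w i) \<in> carrier (opposite_ring Gamma_inf) \<and>
      (\<lambda>i j. A i j /\<^sub>R w i) \<odot>\<^bsub>matrix_ideal_right S\<^esub> diagonal_matrix w = A) weight_filter"
    unfolding eventually_weight_filter
  proof (intro bexI[OF _ v] ballI impI conjI)
    fix w assume w: "w \<in> weights S" and vw: "\<forall>n. v n \<le> w n"
    have Aw: "norm (A i j) \<le> w i" for i j
      using order_trans[OF Av] vw by blast
    show "diagonal_matrix w \<in> carrier (matrix_ideal_right S :: (_, nat \<Rightarrow> nat \<Rightarrow> 'a) module)"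
      using diagonal_matrix_in_matrix_ideal[OF S w] by simp
    show "(\<lambda>i j. A i j /\<^sub>R w i) \<in> carrier (opposite_ring Gamma_inf)"
      using quotient_in_matrix_ideal_linf[OF A weights_nonneg[OF w] Aw] by simp
    have "w i *\<^sub>R (A i j /\<^sub>R w i) = A i j" for i j
      using Aw[of i j] by (cases "w i = 0") auto
    then show "(\<lambda>i j. A i j /\<^sub>R w i) \<odot>\<^bsub>matrix_ideal_right S\<^esub> diagonal_matrix w = A"
      by (simp add: fun_eq_iff mat_mult_diagonal_left)
  qed
next
  fix w and a A :: "nat \<Rightarrow> nat \<Rightarrow> 'a"
  assume "A \<in> carrier (matrix_ideal_right S)"
  then have "finite {j. A i j \<noteq> 0}" for i
    by (simp add: matrix_ideal_def row_col_bounded_row_finite)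
  \<comment> \<open>A value \<open>w i = 0\<close> empties row \<open>i\<close> of the quotient, so
    its product is rewritten over the support of \<open>A\<close> before the two sides are
    compared.\<close>
  then have "mat_mult (\<lambda>i j. A i j /\<^sub>R w i) a i k = (\<Sum>j\<in>{j. A i j \<noteq> 0}. (A i j /\<^sub>R w i) * a j k)" for i k
    by (rule mat_mult_eq_sum) auto
  then show "(\<lambda>i j. (a \<odot>\<^bsub>matrix_ideal_right S\<^esub> A) i j /\<^sub>R w i) =
      a \<otimes>\<^bsub>opposite_ring Gamma_inf\<^esub> (\<lambda>i j. A i j /\<^sub>R w i)"
    by (simp add: fun_eq_iff mat_mult_def[of A] scaleR_sum_right)
qed (simp add: scaleR_add_right)

end

theorem proposition3p8:
  fixes S :: "(nat \<Rightarrow> complex) set"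
  assumes "symmetric_ideal S"
    and "\<And>\<alpha>. \<alpha> \<in> S \<Longrightarrow> (\<lambda>n. complex_of_real (sqrt (cmod (\<alpha> n)))) \<in> S"
  shows "flat_left_module TYPE('k) TYPE('l)
           (Gamma_inf :: (nat \<Rightarrow> nat \<Rightarrow> 'a::complex_banach_algebra_unital) ring)
           (matrix_ideal_left S) \<and>
         flat_right_module TYPE('k) TYPE('l)
           (Gamma_inf :: (nat \<Rightarrow> nat \<Rightarrow> 'a) ring)
           (matrix_ideal_right S)"
  using module_coordinates.flat[OF left_coordinates[OF assms(1)]]
    flat_right_module_coordinates[OF right_module_matrix_ideal right_coordinates, OF assms(1) assms(1)]
  by blast

end
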